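(* Let $\mu_\omega$ be the random Moran measures described in the context, and put $$\alpha=\max\left(\operatorname{ess\,sup}\frac{\log p_1(\omega)}{\log a_1(\omega)},\ \operatorname{ess\,sup}\frac{\log(1-p_1(\omega))}{\log b_1(\omega)}\right),\qquad \beta=\min\left(\operatorname{ess\,inf}\frac{\log p_1(\omega)}{\log a_1(\omega)},\ \operatorname{ess\,inf}\frac{\log(1-p_1(\omega))}{\log b_1(\omega)}\right)$$ (where $\alpha=\infty$ is allowed). There is a set $\Gamma\subseteq\Omega$ of full measure such that $\overline{\dim}_\Phi\mu_\omega=\alpha$ and $\underline{\dim}_\Phi\mu_\omega=\beta$ for all $\omega\in\Gamma$ and for all small dimension functions $\Phi$.
   Context: **Random Moran sets and measures.** Let $(\Omega,\mathcal P)$ be a probability space and fix $0<2A\le B<1$. Let $(a_n(\omega),b_n(\omega),p_n(\omega))$, $n\ge1$, be independent, identically distributed random vectors with values in $\{(x,y,z)\in[0,1]^3: A\le\min(x,y)<x+y\le B\}$ (for a fixed $n$ the three coordinates may be dependent). Assume $\mathbb E(p_n^{-t})<\infty$ and $\mathbb E((1-p_n)^{-t})<\infty$ for some $t>0$ (so almost surely $0<p_n<1$ for all $n$). The Moran interval of step $0$ is $[0,1]$. Each Moran interval $I$ of step $n-1$ has two children, which are Moran intervals of step $n$: the left child is the closed subinterval of $I$ with the same left endpoint and length $a_n(\omega)|I|$, and the right child is the closed subinterval of $I$ with the same right endpoint and length $b_n(\omega)|I|$. Here $|I|$ is the length of $I$. Let $\mathcal C_\omega^{(n)}$ be the union of the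 $2^n$ Moran intervals of step $n$ and $\mathcal C_\omega=\bigcap_n\mathcal C_\omega^{(n)}$. The random measure $\mu_\omega$ is the Borel probability measure on $\mathcal C_\omega$ with $\mu_\omega([0,1])=1$ such that for every Moran interval $I_N$ of step $N$, its left child has measure $p_{N+1}(\omega)\mu_\omega(I_N)$ and its right child has measure $(1-p_{N+1}(\omega))\mu_\omega(I_N)$. **Dimensions.** A dimension function is a map $\Phi:(0,1)\to[0,\infty)$ such that $\Psi(t)=t^{1+\Phi(t)}$ decreases to $0$ as $t$ decreases to $0$ and is doubling: there are $C_1,C_2>0$ with $\Psi(2t)\le C_1\Psi(t)$ for all $0<t<C_2$. It is small if, for $t$ near $0$, $\Phi(t)=H(t)\frac{\log|\log t|}{|\log t|}$ where $H(t)\to0$ as $t\to0$. For a measure $\mu$, with $B(x,r)$ the open ball of centre $x$ and radius $r$, $\overline{\dim}_\Phi\mu$ is the infimum (equal to $\infty$ if there are none) of those $d$ for which there exist $C_1,C_2>0$ such that $\frac{\mu(B(x,R))}{\mu(B(x,r))}\le C_2\left(\frac Rr\right)^d$ for all $x\in\operatorname{supp}\mu$ and all $0<r<R^{1+\Phi(R)}\le R\le C_1$; and $\underline{\dim}_\Phi\mu$ is the supremum of those $d$ for which there exist $C_1,C_2>0$ such that $\frac{\mu(B(x,R))}{\mu(B(x,r))}\ge C_2\left(\frac Rr\right)^d$ for all $x\in\operatorname{supp}\mu$ and all $0<r<R^{1+\Phi(R)}\le R\le C_1$. *)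

theory Defs
  imports "HOL-Probability.Probability" "HOL-Probability.Essential_Supremum"
begin

section \<open>Moran sets and measures\<close>

text \<open>The admissible values of a parameter vector \<open>(a\<^sub>n, b\<^sub>n, p\<^sub>n)\<close>.\<close>

definition moran_parameters :: "real \<Rightarrow> real \<Rightarrow> (real \<times> real \<times> real) set" where
  "moran_parameters A B =
     {(x, y, z). x \<in> {0..1} \<and> y \<in> {0..1} \<and> z \<in> {0..1} \<and>
                 A \<le> min x y \<and> min x y < x + y \<and> x + y \<le> B}"

text \<open>A closed interval is represented by the pair of its endpoints. The sequences \<open>a\<close>, \<open>b\<close>, \<open>p\<close>
  below are only used at indices \<open>n \<ge> 1\<close>.\<close>

definition left_child :: "real \<Rightarrow> real \<times> real \<Rightarrow> real \<times> real" where
  "left_child s I = (fst I, fst I + s * (snd I - fst I))"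

definition right_child :: "real \<Rightarrow> real \<times> real \<Rightarrow> real \<times> real" where
  "right_child s I = (snd I - s * (snd I - fst I), snd I)"

fun moran_intervals :: "(nat \<Rightarrow> real) \<Rightarrow> (nat \<Rightarrow> real) \<Rightarrow> nat \<Rightarrow> (real \<times> real) set" where
  "moran_intervals a b 0 = {(0, 1)}"
| "moran_intervals a b (Suc n) =
     (\<Union>I\<in>moran_intervals a b n. {left_child (a (Suc n)) I, right_child (b (Suc n)) I})"

abbreviation interval_set :: "real \<times> real \<Rightarrow> real set" where
  "interval_set I \<equiv> {fst I..snd I}"

definition moran_set :: "(nat \<Rightarrow> real) \<Rightarrow> (nat \<Rightarrow> real) \<Rightarrow> real set" where
  "moran_set a b = (\<Inter>n. \<Union>I\<in>moran_intervals a b n. interval_set I)"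

text \<open>A measure on the Moran set is regarded as a Borel measure on the real line that is
  concentrated on it.\<close>

definition moran_measure ::
    "(nat \<Rightarrow> real) \<Rightarrow> (nat \<Rightarrow> real) \<Rightarrow> (nat \<Rightarrow> real) \<Rightarrow> real measure \<Rightarrow> bool" where
  "moran_measure a b p \<mu> \<longleftrightarrow>
     sets \<mu> = sets borel \<and> prob_space \<mu> \<and>
     measure \<mu> (moran_set a b) = 1 \<and> measure \<mu> {0..1} = 1 \<and>
     (\<forall>N. \<forall>I\<in>moran_intervals a b N.
        measure \<mu> (interval_set (left_child (a (Suc N)) I)) =
          p (Suc N) * measure \<mu> (interval_set I) \<and>
        measure \<mu> (interval_set (right_child (b (Suc N)) I)) =
          (1 - p (Suc N)) * measure \<mu> (interval_set I))"

section \<open>Dimensions\<close>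

text \<open>A function on \<open>(0, 1)\<close> is given by a total function whose values outside \<open>(0, 1)\<close> are
  irrelevant: wherever a bound on \<open>t\<close> or \<open>R\<close> is existentially quantified below, it can be
  decreased so that only arguments in \<open>(0, 1)\<close> occur.\<close>

definition dimension_function :: "(real \<Rightarrow> real) \<Rightarrow> bool" where
  "dimension_function \<Phi> \<longleftrightarrow>
     (\<forall>t\<in>{0<..<1}. 0 \<le> \<Phi> t) \<and>
     (let \<Psi> = (\<lambda>t. t powr (1 + \<Phi> t)) in
        mono_on {0<..<1} \<Psi> \<and> (\<Psi> \<longlongrightarrow> 0) (at_right 0) \<and>
        (\<exists>C\<^sub>1>0. \<exists>C\<^sub>2>0. \<forall>t. 0 < t \<and> t < C\<^sub>2 \<longrightarrow> \<Psi> (2 * t) \<le> C\<^sub>1 * \<Psi> t))"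

definition small :: "(real \<Rightarrow> real) \<Rightarrow> bool" where
  "small \<Phi> \<longleftrightarrow>
     (\<exists>H. (H \<longlongrightarrow> 0) (at_right 0) \<and>
          (\<forall>\<^sub>F t in at_right 0. \<Phi> t = H t * (ln \<bar>ln t\<bar> / \<bar>ln t\<bar>)))"

definition measure_support :: "'a::topological_space measure \<Rightarrow> 'a set" where
  "measure_support \<mu> = {x. \<forall>U. open U \<and> x \<in> U \<longrightarrow> 0 < emeasure \<mu> U}"

definition upper_dim :: "(real \<Rightarrow> real) \<Rightarrow> 'a::metric_space measure \<Rightarrow> ereal" where
  "upper_dim \<Phi> \<mu> =
     Inf {ereal d | d. \<exists>C\<^sub>1>0. \<exists>C\<^sub>2>0. \<forall>x\<in>measure_support \<mu>. \<forall>r R.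
       0 < r \<and> r < R powr (1 + \<Phi> R) \<and> R powr (1 + \<Phi> R) \<le> R \<and> R \<le> C\<^sub>1 \<longrightarrow>
       measure \<mu> (ball x R) / measure \<mu> (ball x r) \<le> C\<^sub>2 * (R / r) powr d}"

definition lower_dim :: "(real \<Rightarrow> real) \<Rightarrow> 'a::metric_space measure \<Rightarrow> ereal" where
  "lower_dim \<Phi> \<mu> =
     Sup {ereal d | d. \<exists>C\<^sub>1>0. \<exists>C\<^sub>2>0. \<forall>x\<in>measure_support \<mu>. \<forall>r R.
       0 < r \<and> r < R powr (1 + \<Phi> R) \<and> R powr (1 + \<Phi> R) \<le> R \<and> R \<le> C\<^sub>1 \<longrightarrow>
       measure \<mu> (ball x R) / measure \<mu> (ball x r) \<ge> C\<^sub>2 * (R / r) powr d}"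

text \<open>The counterpart of \<^const>\<open>esssup\<close>, with the dual convention for non-measurable functions.\<close>

definition essinf :: "'a measure \<Rightarrow> ('a \<Rightarrow> ereal) \<Rightarrow> ereal" where
  "essinf M f = (if f \<in> borel_measurable M then Liminf (ae_filter M) f else bot)"

end

theory Submission
  imports Defs "HOL-Real_Asymp.Real_Asymp"
begin

text \<open>
  A path through the construction is a sequence of left/right choices. Up to step \<open>n\<close> it selects
  a Moran interval whose length is a product of the factors \<open>a\<close> or \<open>b\<close> chosen on the way and whose
  mass is the product of the corresponding factors \<open>p\<close> or \<open>1 - p\<close>. The children of an interval
  are separated by a fixed proportion \<open>1 - B\<close> of its length, and lengths shrink by a factor of at
  least \<open>A\<close> at each step. Hence, up to constants, the ball of radius \<open>r\<close> about a point of the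
  Moran set has the mass of the interval of length about \<open>r\<close> on the path of that point
  (\<open>ball_approx_above\<close>, \<open>ball_approx_below\<close>). A quotient \<open>\<mu>(B(x,R)) / \<mu>(B(x,r))\<close> is thereby a
  product of factors \<open>1/p\<close> or \<open>1/(1 - p)\<close>, to be compared with the product \<open>R/r\<close> of the factors
  \<open>1/a\<close> or \<open>1/b\<close> at the same steps.

  Almost surely every local exponent \<open>log p\<^sub>n / log a\<^sub>n\<close> and \<open>log (1 - p\<^sub>n) / log b\<^sub>n\<close> lies between
  \<open>\<beta>\<close> and \<open>\<alpha>\<close>. Comparing factor by factor, every \<open>d > \<alpha>\<close> is then admissible for the upper
  dimension and every \<open>d < \<beta>\<close> for the lower one, at all scales and so for every \<open>\<Phi>\<close>
  (\<open>upper_exponentI\<close>, \<open>lower_exponentI\<close>).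

  Conversely let \<open>d < \<alpha>\<close>. One of the two kinds of local exponent exceeds \<open>d\<close> with positive
  probability, so by independence there are almost surely infinitely many \<open>N\<close> after which it does
  so in \<open>c log N\<close> consecutive steps, for some fixed \<open>c > 0\<close> (\<open>AE_log_runs\<close>). Such a run covers
  scales whose quotient \<open>R/r\<close> is at least a power of \<open>N\<close>. For a small dimension function the
  condition \<open>r < R\<^bsup>1+\<Phi>(R)\<^esup>\<close> only asks for \<open>R/r > |log R|\<^bsup>H(R)\<^esup>\<close>, where \<open>|log R|\<close> is comparable
  with \<open>N\<close> and \<open>H(R)\<close> tends to \<open>0\<close>, so these scales are eligible (\<open>log_runs_scales\<close>). Along the path
  that always turns to the side in question, which is the path of the endpoint \<open>0\<close> or \<open>1\<close>, they
  violate the bound with exponent \<open>d\<close>. The argument for \<open>d > \<beta>\<close> is symmetric. The exceptional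
  null set depends on \<open>d\<close> but not on \<open>\<Phi>\<close>, and it suffices to consider rational \<open>d\<close>, so one null
  set serves all \<open>\<Phi>\<close>.
\<close>

section \<open>Runs of logarithmic length in independent trials\<close>

text \<open>Logarithmic length is the scale at which independent trials still produce such runs infinitely
  often, and it already exceeds the gap between \<open>R\<close> and \<open>r\<close> that a small dimension function
  prescribes.\<close>

definition log_runs :: "(nat \<Rightarrow> bool) \<Rightarrow> bool" where
  "log_runs E \<longleftrightarrow> (\<exists>c>0. \<exists>\<^sub>F N in sequentially. \<forall>j. N < j \<and> real j \<le> N + c * ln N \<longrightarrow> E j)"

lemma log_runs_mono:
  assumes "log_runs E" "\<And>j. 1 \<le> j \<Longrightarrow> E j \<Longrightarrow> F j"
  shows "log_runs F"
proof -
  obtain c where c: "c > 0" "\<exists>\<^sub>F N in sequentially. \<forall>j. N < j \<and> real j \<le> N + c * ln N \<longrightarrow> E j"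
    using assms(1) unfolding log_runs_def by blast
  have "\<exists>\<^sub>F N in sequentially. \<forall>j. N < j \<and> real j \<le> N + c * ln N \<longrightarrow> F j"
    by (rule frequently_elim1[OF c(2)]) (simp add: assms(2))
  with c(1) show ?thesis unfolding log_runs_def by blast
qed

text \<open>Let \<open>q\<close> be the probability of a success. A block of at most \<open>ln k / (1 - ln q)\<close> consecutive
  trials consists of successes with probability at least \<open>1/(k + 1)\<close>. Such blocks placed right
  after the squares \<open>k\<^sup>2\<close> are disjoint, hence independent, and the probability that all of those
  with \<open>m \<le> k < m + n\<close> fail is at most the telescoping product of \<open>k/(k + 1)\<close>, which is
  \<open>m/(m + n)\<close> and tends to \<open>0\<close> as \<open>n\<close> grows.\<close>

lemma (in prob_space) AE_log_runs:
  fixes X :: "nat \<Rightarrow> 'a \<Rightarrow> 'b::topological_space"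
  assumes indep: "indep_vars (\<lambda>_. borel) X {1..}"
    and ident: "\<And>n. 1 \<le> n \<Longrightarrow> distr M borel (X n) = distr M borel (X 1)"
    and S: "S \<in> sets borel"
    and pos: "0 < prob (X 1 -` S \<inter> space M)"
  shows "AE \<omega> in M. log_runs (\<lambda>n. X n \<omega> \<in> S)"
proof -
  define q where "q = prob (X 1 -` S \<inter> space M)"
  have q: "0 < q" "q \<le> 1" using pos by (auto simp: q_def)
  have X[measurable]: "X n \<in> M \<rightarrow>\<^sub>M borel" if "1 \<le> n" for n
    using indep that by (auto simp: indep_vars_def)
  have q_eq: "prob (X n -` S \<inter> space M) = q" if "1 \<le> n" for n
    using ident[OF that] measure_distr[OF X[OF that] S] measure_distr[OF X[of 1] S] by (simp add: q_def)
  have ln_q: "ln q \<le> 0" using q by simp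
  \<comment> \<open>the factor \<open>2\<close> compensates for \<open>ln (k\<^sup>2) = 2 * ln k\<close>\<close>
  define c where "c = 1 / (2 * (1 - ln q))"
  have c: "0 < c" "2 * c \<le> 1" "2 * c * ln q \<ge> -1"
    using ln_q by (auto simp: c_def field_simps)
  define K where "K k = {j. k\<^sup>2 < j \<and> real j \<le> real (k\<^sup>2) + c * ln (real (k\<^sup>2))}" for k :: nat
  have K_sub: "K k \<subseteq> {k\<^sup>2<..<(Suc k)\<^sup>2}" for k
  proof (cases "k = 0")
    case False
    have "c * ln (real (k\<^sup>2)) = 2 * c * ln (real k)"
      using False by (simp add: ln_realpow)
    also have "\<dots> \<le> 1 * ln (real k)"
      using c False by (intro mult_right_mono) auto
    also have "\<dots> \<le> real k" using False by (simp add: ln_bound)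
    finally have *: "c * ln (real (k\<^sup>2)) \<le> real k" .
    show ?thesis
    proof
      fix j assume "j \<in> K k"
      hence "k\<^sup>2 < j" "real j \<le> real (k\<^sup>2) + real k" using * by (auto simp: K_def)
      hence "k\<^sup>2 < j" "j \<le> k\<^sup>2 + k" by linarith+
      thus "j \<in> {k\<^sup>2<..<(Suc k)\<^sup>2}" by (auto simp: power2_eq_square)
    qed
  qed (auto simp: K_def)
  have fin_K: "finite (K k)" for k
    by (rule finite_subset[OF K_sub]) simp
  have K_ge: "K k \<subseteq> {1..}" for k by (auto simp: K_def)
  have disj: "disjoint_family_on K UNIV"
  proof -
    have "K k \<inter> K l = {}" if "k < l" for k l
    proof -
      have "(Suc k)\<^sup>2 \<le> l\<^sup>2" using that by (intro power_mono) auto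
      moreover have "j < (Suc k)\<^sup>2" if "j \<in> K k" for j using K_sub[of k] that by auto
      moreover have "l\<^sup>2 < j" if "j \<in> K l" for j using K_sub[of l] that by auto
      ultimately show ?thesis by (meson disjoint_iff le_less_trans less_asym less_le_trans)
    qed
    thus ?thesis unfolding disjoint_family_on_def by (metis Int_commute linorder_neqE_nat)
  qed
  have card_K: "real (card (K k)) \<le> 2 * c * ln (real k)" if "1 \<le> k" for k
  proof -
    have "K k \<subseteq> {k\<^sup>2<..k\<^sup>2 + nat \<lfloor>c * ln (real (k\<^sup>2))\<rfloor>}"
    proof
      fix j assume "j \<in> K k"
      hence j: "k\<^sup>2 < j" "real j \<le> real (k\<^sup>2) + c * ln (real (k\<^sup>2))" by (auto simp: K_def)
      hence "real (j - k\<^sup>2) \<le> c * ln (real (k\<^sup>2))" by (simp add: of_nat_diff)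
      hence "j - k\<^sup>2 \<le> nat \<lfloor>c * ln (real (k\<^sup>2))\<rfloor>" by (rule le_nat_floor)
      thus "j \<in> {k\<^sup>2<..k\<^sup>2 + nat \<lfloor>c * ln (real (k\<^sup>2))\<rfloor>}" using j(1) by simp
    qed
    hence "card (K k) \<le> nat \<lfloor>c * ln (real (k\<^sup>2))\<rfloor>"
      using card_mono[of "{k\<^sup>2<..k\<^sup>2 + nat \<lfloor>c * ln (real (k\<^sup>2))\<rfloor>}"] by fastforce
    hence "real (card (K k)) \<le> real (nat \<lfloor>c * ln (real (k\<^sup>2))\<rfloor>)" by simp
    also have "\<dots> \<le> c * ln (real (k\<^sup>2))" using c that by simp
    finally show ?thesis using that by (simp add: ln_realpow)
  qed
  have pow_ge: "1 / real (Suc k) \<le> q ^ card (K k)" if "1 \<le> k" for k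
  proof -
    have "1 / real (Suc k) \<le> 1 / real k" using that by (simp add: frac_le)
    also have "\<dots> = exp (- ln (real k))" using that by (simp add: exp_minus divide_inverse)
    also have "\<dots> \<le> exp (real (card (K k)) * ln q)"
    proof -
      have "-1 * ln (real k) \<le> (2 * c * ln q) * ln (real k)"
        using c that by (intro mult_right_mono) auto
      also have "\<dots> = (2 * c * ln (real k)) * ln q" by simp
      also have "\<dots> \<le> real (card (K k)) * ln q"
        using card_K[OF that] ln_q by (intro mult_right_mono_neg) auto
      finally show ?thesis by simp
    qed
    also have "\<dots> = q ^ card (K k)" using q by (simp add: exp_of_nat_mult)
    finally show ?thesis .
  qed
  \<comment> \<open>the outcomes within a block form one random variable per block, independent of the others\<close>
  define Y where "Y k \<omega> = restrict (\<lambda>i. X i \<omega>) (K k)" for k \<omega>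
  have indY: "indep_vars (\<lambda>k. PiM (K k) (\<lambda>_. borel)) Y UNIV"
    unfolding Y_def by (rule indep_vars_restrict[OF indep K_ge disj])
  define F where "F k = PiE (K k) (\<lambda>_. S)" for k
  have F: "F k \<in> sets (PiM (K k) (\<lambda>_. borel))" for k
    unfolding F_def using S fin_K by (intro sets_PiM_I_finite) auto
  define G where "G k = space (PiM (K k) (\<lambda>_. borel)) - F k" for k
  have G: "G k \<in> sets (PiM (K k) (\<lambda>_. borel))" for k
    using F by (auto simp: G_def)
  have YF: "Y k -` F k \<inter> space M = {\<omega>\<in>space M. \<forall>j\<in>K k. X j \<omega> \<in> S}" for k
    by (auto simp: Y_def F_def PiE_iff)
  have prob_F: "prob (Y k -` F k \<inter> space M) = q ^ card (K k)" for k
  proof (cases "K k = {}")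
    case True
    thus ?thesis unfolding YF by (simp add: prob_space)
  next
    case False
    have "Y k -` F k \<inter> space M = (\<Inter>j\<in>K k. X j -` S \<inter> space M)"
      unfolding YF using False by auto
    hence "prob (Y k -` F k \<inter> space M) = (\<Prod>j\<in>K k. prob (X j -` S \<inter> space M))"
      using indep_varsD[OF indep False fin_K K_ge, of "\<lambda>_. S"] S by simp
    also have "\<dots> = (\<Prod>j\<in>K k. q)"
      using K_ge by (intro prod.cong refl q_eq) auto
    finally show ?thesis by simp
  qed
  have Y[measurable]: "Y k \<in> M \<rightarrow>\<^sub>M PiM (K k) (\<lambda>_. borel)" for k
    using indY by (auto simp: indep_vars_def)
  have YG: "Y k -` G k \<inter> space M = space M - (Y k -` F k \<inter> space M)" for k
    using measurable_space[OF Y[of k]] by (auto simp: G_def)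
  have YG_iff: "Y k \<omega> \<in> G k \<longleftrightarrow> \<not> (\<forall>j\<in>K k. X j \<omega> \<in> S)" if "\<omega> \<in> space M" for k \<omega>
    using YG[of k] YF[of k] that by blast
  have prob_G: "prob (Y k -` G k \<inter> space M) \<le> real k / real (Suc k)" if "1 \<le> k" for k
  proof -
    have "prob (Y k -` G k \<inter> space M) = 1 - q ^ card (K k)"
      unfolding YG using measurable_sets[OF Y F] by (subst prob_compl) (auto simp: prob_F)
    also have "\<dots> \<le> 1 - 1 / real (Suc k)" using pow_ge[OF that] by simp
    also have "\<dots> = real k / real (Suc k)" by (simp add: field_simps)
    finally show ?thesis .
  qed
  have AE_m: "AE \<omega> in M. \<exists>k\<ge>m. \<forall>j\<in>K k. X j \<omega> \<in> S" if m: "1 \<le> m" for m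
  proof -
    define Z where "Z = {\<omega>\<in>space M. \<forall>k\<ge>m. Y k \<omega> \<in> G k}"
    have Z_sub: "Z \<subseteq> (\<Inter>k\<in>{m..<m+n}. Y k -` G k \<inter> space M)" if "1 \<le> n" for n
      using that by (auto simp: Z_def)
    have sets_Z: "Z \<in> sets M"
    proof -
      have "Z = (\<Inter>k\<in>{m..}. Y k -` G k \<inter> space M)" by (auto simp: Z_def)
      also have "\<dots> \<in> sets M" using measurable_sets[OF Y G] by (intro sets.countable_INT') auto
      finally show ?thesis .
    qed
    have bound: "prob Z \<le> real m / real (m + n)" if n: "1 \<le> n" for n
    proof -
      have "prob Z \<le> prob (\<Inter>k\<in>{m..<m+n}. Y k -` G k \<inter> space M)"
        using n measurable_sets[OF Y G] by (intro finite_measure_mono[OF Z_sub] sets.finite_INT) auto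
      also have "\<dots> = (\<Prod>k\<in>{m..<m+n}. prob (Y k -` G k \<inter> space M))"
        using n G by (intro indep_varsD[OF indY]) auto
      also have "\<dots> \<le> (\<Prod>k\<in>{m..<m+n}. real k / real (Suc k))"
        using prob_G m by (intro prod_mono) auto
      also have "\<dots> = real m / real (m + n)"
        using m by (induction n) (simp_all add: field_simps)
      finally show ?thesis .
    qed
    have "prob Z \<le> 0"
    proof (rule tendsto_lowerbound)
      show "((\<lambda>n. real m / real (m + n)) \<longlongrightarrow> 0) sequentially" by real_asymp
      show "\<forall>\<^sub>F n in sequentially. prob Z \<le> real m / real (m + n)"
        using bound by (auto simp: eventually_sequentially)
    qed simp
    hence "Z \<in> null_sets M" using sets_Z
      by (simp add: null_sets_def emeasure_eq_measure measure_le_0_iff)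
    moreover have "{\<omega>\<in>space M. \<not> (\<exists>k\<ge>m. \<forall>j\<in>K k. X j \<omega> \<in> S)} \<subseteq> Z"
      using YG_iff by (auto simp: Z_def)
    ultimately show ?thesis by (rule AE_I')
  qed
  have "AE \<omega> in M. \<forall>m. 1 \<le> m \<longrightarrow> (\<exists>k\<ge>m. \<forall>j\<in>K k. X j \<omega> \<in> S)"
    unfolding AE_all_countable using AE_m by auto
  thus ?thesis
  proof (rule AE_mp, intro AE_I2 impI)
    fix \<omega> assume *: "\<forall>m. 1 \<le> m \<longrightarrow> (\<exists>k\<ge>m. \<forall>j\<in>K k. X j \<omega> \<in> S)"
    have "\<exists>\<^sub>F N in sequentially. \<forall>j. N < j \<and> real j \<le> N + c * ln N \<longrightarrow> X j \<omega> \<in> S"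
      unfolding frequently_sequentially
    proof
      fix m
      obtain k where k: "k \<ge> max 1 m" "\<forall>j\<in>K k. X j \<omega> \<in> S" using * by (metis max.cobounded1)
      have "m \<le> k\<^sup>2" using k(1) by (metis le_square le_trans max.bounded_iff power2_eq_square)
      thus "\<exists>n\<ge>m. \<forall>j. n < j \<and> real j \<le> n + c * ln n \<longrightarrow> X j \<omega> \<in> S"
        using k(2) by (intro exI[of _ "k\<^sup>2"]) (auto simp: K_def)
    qed
    with c(1) show "log_runs (\<lambda>n. X n \<omega> \<in> S)" unfolding log_runs_def by blast
  qed
qed

lemma (in prob_space) AE_ident_distr:
  fixes X :: "nat \<Rightarrow> 'a \<Rightarrow> 'b::topological_space" and P :: "'b \<Rightarrow> bool"
  assumes rv: "\<And>n. 1 \<le> n \<Longrightarrow> X n \<in> M \<rightarrow>\<^sub>M borel"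
    and ident: "\<And>n. 1 \<le> n \<Longrightarrow> distr M borel (X n) = distr M borel (X 1)"
    and P: "Measurable.pred borel P" and AE_1: "AE \<omega> in M. P (X 1 \<omega>)"
  shows "AE \<omega> in M. \<forall>n\<ge>1. P (X n \<omega>)"
proof -
  have iff: "(AE \<omega> in M. P (X n \<omega>)) \<longleftrightarrow> (AE x in distr M borel (X n). P x)" if "1 \<le> n" for n
    using P rv[OF that] by (subst AE_distr_iff) (auto simp: pred_def)
  have "AE \<omega> in M. P (X n \<omega>)" if "1 \<le> n" for n
    unfolding iff[OF that] ident[OF that] using AE_1 unfolding iff[OF order_refl] .
  thus ?thesis by (simp add: AE_all_countable)
qed

text \<open>Exceeding a real number below the essential supremum has positive probability, so runs exist
  almost surely. Monotonicity in the threshold reduces the uncountably many thresholds \<open>d\<close> to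
  rational ones.\<close>

lemma (in prob_space) AE_log_runs_esssup:
  fixes X :: "nat \<Rightarrow> 'a \<Rightarrow> 'b::topological_space" and h :: "'b \<Rightarrow> real"
  assumes indep: "indep_vars (\<lambda>_. borel) X {1..}"
    and ident: "\<And>n. 1 \<le> n \<Longrightarrow> distr M borel (X n) = distr M borel (X 1)"
    and h[measurable]: "h \<in> borel_measurable borel"
  shows "AE \<omega> in M. (\<forall>n\<ge>1. ereal (h (X n \<omega>)) \<le> esssup M (\<lambda>\<omega>. ereal (h (X 1 \<omega>)))) \<and>
    (\<forall>d. ereal d < esssup M (\<lambda>\<omega>. ereal (h (X 1 \<omega>))) \<longrightarrow> log_runs (\<lambda>n. d < h (X n \<omega>)))"
proof -
  define s where "s = esssup M (\<lambda>\<omega>. ereal (h (X 1 \<omega>)))"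
  have X[measurable]: "X n \<in> M \<rightarrow>\<^sub>M borel" if "1 \<le> n" for n
    using indep that by (auto simp: indep_vars_def)
  have "AE \<omega> in M. \<forall>n\<ge>1. ereal (h (X n \<omega>)) \<le> s"
  proof (rule AE_ident_distr[of X "\<lambda>x. ereal (h x) \<le> s"])
    show "AE \<omega> in M. ereal (h (X 1 \<omega>)) \<le> s" unfolding s_def by (rule esssup_AE)
    show "Measurable.pred borel (\<lambda>x. ereal (h x) \<le> s)" by measurable
  qed (fact X ident)+
  moreover have "AE \<omega> in M. \<forall>q\<in>{q\<in>\<rat>. ereal q < s}. log_runs (\<lambda>n. X n \<omega> \<in> {x. q < h x})"
  proof (subst AE_ball_countable)
    show "countable {q\<in>\<rat>. ereal q < s}" by (rule countable_subset[OF _ countable_rat]) auto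
    show "\<forall>q\<in>{q\<in>\<rat>. ereal q < s}. AE \<omega> in M. log_runs (\<lambda>n. X n \<omega> \<in> {x. q < h x})"
    proof
      fix q assume q: "q \<in> {q\<in>\<rat>. ereal q < s}"
      have "{x. q < h x} \<in> sets borel" by measurable
      moreover have "emeasure M {\<omega>\<in>space M. ereal (h (X 1 \<omega>)) > ereal q} > 0"
        using q X[of 1] by (intro esssup_pos_measure) (auto simp: s_def)
      hence "0 < prob (X 1 -` {x. q < h x} \<inter> space M)"
        by (simp add: emeasure_eq_measure vimage_def Int_def conj_commute)
      ultimately show "AE \<omega> in M. log_runs (\<lambda>n. X n \<omega> \<in> {x. q < h x})"
        by (intro AE_log_runs[OF indep ident])
    qed
  qed
  ultimately show ?thesis
    unfolding s_def[symmetric]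
  proof eventually_elim
    case (elim \<omega>)
    have "log_runs (\<lambda>n. d < h (X n \<omega>))" if d: "ereal d < s" for d
    proof -
      obtain e where "d < e" "ereal e < s" using ereal_dense2[OF d] by auto
      moreover obtain q where "q \<in> \<rat>" "d < q" "q < e" using Rats_dense_in_real[OF \<open>d < e\<close>] by blast
      ultimately have "log_runs (\<lambda>n. X n \<omega> \<in> {x. q < h x})"
        using elim(2) less_trans[of "ereal q" "ereal e" s] by auto
      thus ?thesis by (rule log_runs_mono) (use \<open>d < q\<close> in auto)
    qed
    with elim(1) show ?case by blast
  qed
qed

lemma essinf_eq_uminus_esssup:
  fixes f :: "'a \<Rightarrow> ereal"
  assumes [measurable]: "f \<in> borel_measurable M"
  shows "essinf M f = - esssup M (\<lambda>x. - f x)"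
  by (simp add: essinf_def esssup_def ereal_Limsup_uminus)

lemma (in prob_space) AE_log_runs_essinf:
  fixes X :: "nat \<Rightarrow> 'a \<Rightarrow> 'b::topological_space" and h :: "'b \<Rightarrow> real"
  assumes indep: "indep_vars (\<lambda>_. borel) X {1..}"
    and ident: "\<And>n. 1 \<le> n \<Longrightarrow> distr M borel (X n) = distr M borel (X 1)"
    and h[measurable]: "h \<in> borel_measurable borel"
  shows "AE \<omega> in M. (\<forall>n\<ge>1. essinf M (\<lambda>\<omega>. ereal (h (X 1 \<omega>))) \<le> ereal (h (X n \<omega>))) \<and>
    (\<forall>d. essinf M (\<lambda>\<omega>. ereal (h (X 1 \<omega>))) < ereal d \<longrightarrow> log_runs (\<lambda>n. h (X n \<omega>) < d))"
proof -
  have X[measurable]: "X n \<in> M \<rightarrow>\<^sub>M borel" if "1 \<le> n" for n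
    using indep that by (auto simp: indep_vars_def)
  define s where "s = esssup M (\<lambda>\<omega>. ereal (- h (X 1 \<omega>)))"
  have inf: "essinf M (\<lambda>\<omega>. ereal (h (X 1 \<omega>))) = - s"
    using X[of 1] by (subst essinf_eq_uminus_esssup) (auto simp: s_def)
  have *: "(\<lambda>x. - h x) \<in> borel_measurable borel" by measurable
  have "AE \<omega> in M. (\<forall>n\<ge>1. ereal (- h (X n \<omega>)) \<le> s) \<and>
      (\<forall>d. ereal d < s \<longrightarrow> log_runs (\<lambda>n. d < - h (X n \<omega>)))"
    unfolding s_def by (rule AE_log_runs_esssup[OF indep ident *])
  thus ?thesis
    unfolding inf
  proof eventually_elim
    case (elim \<omega>)
    have "- s \<le> ereal (h (X n \<omega>))" if "1 \<le> n" for n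
      using elim that ereal_uminus_le_reorder[of s "ereal (h (X n \<omega>))"] by simp
    moreover have "log_runs (\<lambda>n. h (X n \<omega>) < d)" if "- s < ereal d" for d
    proof -
      have "ereal (- d) < s" using that ereal_uminus_less_reorder[of s "ereal d"] by simp
      hence "log_runs (\<lambda>n. - d < - h (X n \<omega>))" using elim by blast
      thus ?thesis by simp
    qed
    ultimately show ?case by blast
  qed
qed

section \<open>Admissible exponents\<close>

definition upper_exponent :: "(real \<Rightarrow> real) \<Rightarrow> 'a::metric_space measure \<Rightarrow> real \<Rightarrow> bool" where
  "upper_exponent \<Phi> \<mu> d \<longleftrightarrow> (\<exists>C\<^sub>1>0. \<exists>C\<^sub>2>0. \<forall>x\<in>measure_support \<mu>. \<forall>r R.
     0 < r \<and> r < R powr (1 + \<Phi> R) \<and> R powr (1 + \<Phi> R) \<le> R \<and> R \<le> C\<^sub>1 \<longrightarrow>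
     measure \<mu> (ball x R) / measure \<mu> (ball x r) \<le> C\<^sub>2 * (R / r) powr d)"

definition lower_exponent :: "(real \<Rightarrow> real) \<Rightarrow> 'a::metric_space measure \<Rightarrow> real \<Rightarrow> bool" where
  "lower_exponent \<Phi> \<mu> d \<longleftrightarrow> (\<exists>C\<^sub>1>0. \<exists>C\<^sub>2>0. \<forall>x\<in>measure_support \<mu>. \<forall>r R.
     0 < r \<and> r < R powr (1 + \<Phi> R) \<and> R powr (1 + \<Phi> R) \<le> R \<and> R \<le> C\<^sub>1 \<longrightarrow>
     measure \<mu> (ball x R) / measure \<mu> (ball x r) \<ge> C\<^sub>2 * (R / r) powr d)"

text \<open>Real numbers are dense in the extended reals, so the values \<open>d\<close> on either side of \<open>\<alpha>\<close> decide,
  also for \<open>\<alpha> = \<infinity>\<close>; nothing has to be known at \<open>d = \<alpha>\<close> itself.\<close>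

lemma upper_dim_eqI:
  assumes "\<And>d. \<alpha> < ereal d \<Longrightarrow> upper_exponent \<Phi> \<mu> d"
    and "\<And>d. ereal d < \<alpha> \<Longrightarrow> \<not> upper_exponent \<Phi> \<mu> d"
  shows "upper_dim \<Phi> \<mu> = \<alpha>"
proof -
  have "upper_dim \<Phi> \<mu> = Inf {ereal d | d. upper_exponent \<Phi> \<mu> d}"
    unfolding upper_dim_def upper_exponent_def ..
  also have "\<dots> = \<alpha>"
  proof (rule antisym)
    show "\<alpha> \<le> Inf {ereal d | d. upper_exponent \<Phi> \<mu> d}"
      using assms(2) by (intro Inf_greatest) (auto simp: not_less[symmetric])
    show "Inf {ereal d | d. upper_exponent \<Phi> \<mu> d} \<le> \<alpha>"
    proof (rule dense_ge)
      fix y assume "\<alpha> < y"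
      then obtain d where "\<alpha> < ereal d" "ereal d < y" using ereal_dense2 by blast
      thus "Inf {ereal d | d. upper_exponent \<Phi> \<mu> d} \<le> y"
        using assms(1) by (intro order_trans[OF Inf_lower less_imp_le]) auto
    qed
  qed
  finally show ?thesis .
qed

lemma lower_dim_eqI:
  assumes "\<And>d. ereal d < \<beta> \<Longrightarrow> lower_exponent \<Phi> \<mu> d"
    and "\<And>d. \<beta> < ereal d \<Longrightarrow> \<not> lower_exponent \<Phi> \<mu> d"
  shows "lower_dim \<Phi> \<mu> = \<beta>"
proof -
  have "lower_dim \<Phi> \<mu> = Sup {ereal d | d. lower_exponent \<Phi> \<mu> d}"
    unfolding lower_dim_def lower_exponent_def ..
  also have "\<dots> = \<beta>"
  proof (rule antisym)
    show "Sup {ereal d | d. lower_exponent \<Phi> \<mu> d} \<le> \<beta>"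
      using assms(2) by (intro Sup_least) (auto simp: not_less[symmetric])
    show "\<beta> \<le> Sup {ereal d | d. lower_exponent \<Phi> \<mu> d}"
    proof (rule dense_le)
      fix y assume "y < \<beta>"
      then obtain d where "y < ereal d" "ereal d < \<beta>" using ereal_dense2 by blast
      thus "y \<le> Sup {ereal d | d. lower_exponent \<Phi> \<mu> d}"
        using assms(1) by (intro order_trans[OF less_imp_le Sup_upper]) auto
    qed
  qed
  finally show ?thesis .
qed

text \<open>For \<open>\<Phi> t = H t * ln |ln t| / |ln t|\<close> the power \<open>t\<^bsup>\<Phi> t\<^esup>\<close> is \<open>|ln t|\<^bsup>- H t\<^esup>\<close>, and \<open>H t < \<epsilon>\<close>
  near \<open>0\<close>.\<close>

lemma small_powr_ge:
  assumes "small \<Phi>" "0 < \<epsilon>"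
  shows "\<forall>\<^sub>F t in at_right 0. t * (- ln t) powr - \<epsilon> \<le> t powr (1 + \<Phi> t)"
proof -
  obtain H where H: "(H \<longlongrightarrow> 0) (at_right 0)"
    "\<forall>\<^sub>F t in at_right 0. \<Phi> t = H t * (ln \<bar>ln t\<bar> / \<bar>ln t\<bar>)"
    using assms(1) unfolding small_def by blast
  have "\<forall>\<^sub>F t in at_right (0::real). 0 < t \<and> t < exp (-1)"
    using eventually_at_right_real[of 0 "exp (-1) :: real"] by simp
  with H(2) order_tendstoD(2)[OF H(1) assms(2)] show ?thesis
  proof eventually_elim
    case (elim t)
    have ln_t: "1 < - ln t" using elim(3) ln_less_cancel_iff[of t "exp (-1)"] by simp
    have "- \<epsilon> * ln (- ln t) \<le> - H t * ln (- ln t)"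
      using elim(2) ln_t by (intro mult_right_mono) auto
    also have "- H t * ln (- ln t) = \<Phi> t * ln t"
      using elim(1) ln_t by (simp add: abs_if field_simps)
    finally have "(- ln t) powr - \<epsilon> \<le> t powr \<Phi> t"
      using ln_t elim(3) by (simp add: powr_def)
    thus ?case using elim(3) by (simp add: powr_add mult_left_mono)
  qed
qed

text \<open>Used with \<open>Q = R/r\<close>: multiplicative constants cannot make up for a smaller exponent.\<close>

lemma powr_dominates:
  fixes d d' D :: real
  assumes "d < d'"
  obtains K where "\<And>Q. K \<le> Q \<Longrightarrow> D * Q powr d < Q powr d'"
proof
  fix Q assume Q: "(\<bar>D\<bar> + 1) powr (1 / (d' - d)) \<le> Q"
  moreover have "0 < (\<bar>D\<bar> + 1) powr (1 / (d' - d))" by simp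
  ultimately have Q_pos: "0 < Q" by linarith
  have "D < ((\<bar>D\<bar> + 1) powr (1 / (d' - d))) powr (d' - d)"
    using assms by (simp add: powr_powr)
  also have "\<dots> \<le> Q powr (d' - d)" using Q assms by (intro powr_mono2) auto
  finally have "D * Q powr d < Q powr (d' - d) * Q powr d"
    using Q_pos by (intro mult_strict_right_mono) auto
  also have "\<dots> = Q powr d'" by (simp add: powr_add[symmetric])
  finally show "D * Q powr d < Q powr d'" .
qed

section \<open>Moran intervals along a path\<close>

text \<open>One realisation of the random construction, with the degenerate weights \<open>0\<close> and \<open>1\<close> excluded.\<close>

locale moran_system =
  fixes a b p :: "nat \<Rightarrow> real" and A B :: real and \<mu> :: "real measure"
  assumes A_pos: "0 < A" and B_less: "B < 1"
    and a_ge: "1 \<le> n \<Longrightarrow> A \<le> a n" and b_ge: "1 \<le> n \<Longrightarrow> A \<le> b n"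
    and ab_le: "1 \<le> n \<Longrightarrow> a n + b n \<le> B"
    and p_pos: "1 \<le> n \<Longrightarrow> 0 < p n" and p_less: "1 \<le> n \<Longrightarrow> p n < 1"
    and moran: "moran_measure a b p \<mu>"
begin

text \<open>A path is a sequence \<open>\<sigma>\<close> whose entry \<open>\<sigma> n\<close> tells whether step \<open>n \<ge> 1\<close> turns left.\<close>

definition ratio :: "(nat \<Rightarrow> bool) \<Rightarrow> nat \<Rightarrow> real" where
  "ratio \<sigma> n = (if \<sigma> n then a n else b n)"

definition weight :: "(nat \<Rightarrow> bool) \<Rightarrow> nat \<Rightarrow> real" where
  "weight \<sigma> n = (if \<sigma> n then p n else 1 - p n)"

primrec cell :: "(nat \<Rightarrow> bool) \<Rightarrow> nat \<Rightarrow> real \<times> real" where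
  "cell \<sigma> 0 = (0, 1)"
| "cell \<sigma> (Suc n) = (if \<sigma> (Suc n) then left_child (a (Suc n)) (cell \<sigma> n)
                                   else right_child (b (Suc n)) (cell \<sigma> n))"

definition len :: "(nat \<Rightarrow> bool) \<Rightarrow> nat \<Rightarrow> real" where
  "len \<sigma> n = (\<Prod>i\<in>{0<..n}. ratio \<sigma> i)"

definition mass :: "(nat \<Rightarrow> bool) \<Rightarrow> nat \<Rightarrow> real" where
  "mass \<sigma> n = (\<Prod>i\<in>{0<..n}. weight \<sigma> i)"

lemma ratio_bounds: "A \<le> ratio \<sigma> n" "ratio \<sigma> n \<le> B" if "1 \<le> n"
  using a_ge[OF that] b_ge[OF that] ab_le[OF that] A_pos by (auto simp: ratio_def)

lemma B_pos: "0 < B" and A_le_1: "A \<le> 1"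
  using ratio_bounds[of 1 undefined] A_pos B_less by auto

lemma ratio_pos: "1 \<le> n \<Longrightarrow> 0 < ratio \<sigma> n" and ratio_less: "1 \<le> n \<Longrightarrow> ratio \<sigma> n < 1"
  using ratio_bounds[of n \<sigma>] A_pos B_less by force+

lemma weight_pos: "1 \<le> n \<Longrightarrow> 0 < weight \<sigma> n" and weight_less: "1 \<le> n \<Longrightarrow> weight \<sigma> n < 1"
  using p_pos[of n] p_less[of n] by (auto simp: weight_def)

lemma greaterThanAtMost_Suc: "{0<..Suc n} = insert (Suc n) {0<..n}"
  by auto

lemma len_0 [simp]: "len \<sigma> 0 = 1" and mass_0 [simp]: "mass \<sigma> 0 = 1"
  by (simp_all add: len_def mass_def)

lemma len_Suc: "len \<sigma> (Suc n) = len \<sigma> n * ratio \<sigma> (Suc n)"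
  and mass_Suc: "mass \<sigma> (Suc n) = mass \<sigma> n * weight \<sigma> (Suc n)"
  by (simp_all add: len_def mass_def greaterThanAtMost_Suc)

lemma len_split: "len \<sigma> M = len \<sigma> N * (\<Prod>i\<in>{N<..M}. ratio \<sigma> i)"
  and mass_split: "mass \<sigma> M = mass \<sigma> N * (\<Prod>i\<in>{N<..M}. weight \<sigma> i)" if "N \<le> M"
proof -
  have "{0<..M} = {0<..N} \<union> {N<..M}" using that by auto
  thus "len \<sigma> M = len \<sigma> N * (\<Prod>i\<in>{N<..M}. ratio \<sigma> i)"
    "mass \<sigma> M = mass \<sigma> N * (\<Prod>i\<in>{N<..M}. weight \<sigma> i)"
    unfolding len_def mass_def by (simp_all add: prod.union_disjoint)
qed

lemma len_pos: "0 < len \<sigma> n" and mass_pos: "0 < mass \<sigma> n"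
  unfolding len_def mass_def by (auto intro!: prod_pos ratio_pos weight_pos)

lemma len_antimono: "N \<le> M \<Longrightarrow> len \<sigma> M \<le> len \<sigma> N"
  and mass_antimono: "N \<le> M \<Longrightarrow> mass \<sigma> M \<le> mass \<sigma> N"
proof -
  have "len \<sigma> (Suc n) \<le> len \<sigma> n" for n
    unfolding len_Suc using len_pos[of \<sigma> n] ratio_less[of "Suc n" \<sigma>]
    by (intro mult_left_le) auto
  thus "N \<le> M \<Longrightarrow> len \<sigma> M \<le> len \<sigma> N" by (rule lift_Suc_antimono_le)
  have "mass \<sigma> (Suc n) \<le> mass \<sigma> n" for n
    unfolding mass_Suc using mass_pos[of \<sigma> n] weight_less[of "Suc n" \<sigma>]
    by (intro mult_left_le) auto
  thus "N \<le> M \<Longrightarrow> mass \<sigma> M \<le> mass \<sigma> N" by (rule lift_Suc_antimono_le)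
qed

lemma len_ge: "A ^ n \<le> len \<sigma> n"
proof (induction n)
  case (Suc n)
  have "A ^ n * A \<le> len \<sigma> n * ratio \<sigma> (Suc n)"
    using Suc A_pos ratio_bounds(1)[of "Suc n" \<sigma>] len_pos[of \<sigma> n] by (intro mult_mono) auto
  thus ?case by (simp add: len_Suc mult.commute)
qed simp

lemma len_le: "N \<le> M \<Longrightarrow> len \<sigma> M \<le> len \<sigma> N * B ^ (M - N)"
proof (induction M rule: dec_induct)
  case (step n)
  have "len \<sigma> n * ratio \<sigma> (Suc n) \<le> (len \<sigma> N * B ^ (n - N)) * B"
    using step ratio_bounds[of "Suc n" \<sigma>] ratio_pos[of "Suc n" \<sigma>] len_pos[of \<sigma>] B_pos
    by (intro mult_mono) (auto simp: less_imp_le)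
  thus ?case using step by (simp add: len_Suc Suc_diff_le mult_ac)
qed simp

lemma len_tendsto: "len \<sigma> \<longlonglongrightarrow> 0"
proof (rule tendsto_sandwich)
  show "\<forall>\<^sub>F n in sequentially. 0 \<le> len \<sigma> n" using len_pos by (auto simp: less_imp_le)
  show "\<forall>\<^sub>F n in sequentially. len \<sigma> n \<le> B ^ n" using len_le[of 0] by auto
  show "(\<lambda>n. B ^ n) \<longlonglongrightarrow> 0" using B_pos B_less by (intro LIMSEQ_realpow_zero) auto
qed simp

lemma first_len_less:
  assumes "0 < t"
  obtains N where "len \<sigma> N < t" "\<And>n. n < N \<Longrightarrow> t \<le> len \<sigma> n"
proof -
  have "\<exists>N. len \<sigma> N < t"
    using order_tendstoD(2)[OF len_tendsto assms] by (auto simp: eventually_sequentially)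
  from exists_least_iff[THEN iffD1, OF this] show thesis
    using that by (auto simp: not_less)
qed

text \<open>Between two steps of a path, mass and length are products over the same index set, so a
  comparison of the factors gives a comparison of the products.\<close>

lemma mass_ratio_ge:
  assumes "N \<le> M" "\<And>i. i \<in> {N<..M} \<Longrightarrow> ratio \<sigma> i powr d \<le> weight \<sigma> i"
  shows "mass \<sigma> N / mass \<sigma> M \<le> (len \<sigma> N / len \<sigma> M) powr d"
proof -
  let ?r = "\<Prod>i\<in>{N<..M}. ratio \<sigma> i" and ?w = "\<Prod>i\<in>{N<..M}. weight \<sigma> i"
  have "ratio \<sigma> i \<noteq> 0" if "0 < i" for i using ratio_pos[of i \<sigma>] that by simp
  hence nz: "?r \<noteq> 0" by auto
  have "?r powr d = (\<Prod>i\<in>{N<..M}. ratio \<sigma> i powr d)"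
    by (intro prod_powr_distrib)
  also have "\<dots> \<le> ?w" using assms(2) by (intro prod_mono) auto
  finally have "1 / ?w \<le> 1 / ?r powr d" using nz by (intro frac_le) auto
  also have "\<dots> = (1 / ?r) powr d" by (simp add: powr_divide)
  finally show ?thesis
    using len_pos[of \<sigma> N] mass_pos[of \<sigma> N] by (simp add: len_split[OF assms(1)] mass_split[OF assms(1)])
qed

lemma mass_ratio_le:
  assumes "N \<le> M" "\<And>i. i \<in> {N<..M} \<Longrightarrow> weight \<sigma> i \<le> ratio \<sigma> i powr d"
  shows "(len \<sigma> N / len \<sigma> M) powr d \<le> mass \<sigma> N / mass \<sigma> M"
proof -
  let ?r = "\<Prod>i\<in>{N<..M}. ratio \<sigma> i" and ?w = "\<Prod>i\<in>{N<..M}. weight \<sigma> i"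
  have r: "0 < ?r" by (auto intro!: prod_pos ratio_pos)
  have w: "0 < ?w" by (auto intro!: prod_pos weight_pos)
  have "?w \<le> (\<Prod>i\<in>{N<..M}. ratio \<sigma> i powr d)" 
    using assms(2) by (intro prod_mono) (auto simp: less_imp_le weight_pos)
  also have "\<dots> = ?r powr d" 
    by (intro prod_powr_distrib[symmetric])
  finally have "1 / ?r powr d \<le> 1 / ?w" using w by (intro frac_le) auto
  moreover have "1 / ?r powr d = (1 / ?r) powr d" using r by (simp add: powr_divide)
  ultimately show ?thesis
    using len_pos[of \<sigma> N] mass_pos[of \<sigma> N] by (simp add: len_split[OF assms(1)] mass_split[OF assms(1)])
qed

lemma cell_in_intervals: "cell \<sigma> n \<in> moran_intervals a b n"
  by (induction n) auto

lemma cell_cong: "(\<And>i. i \<in> {0<..n} \<Longrightarrow> \<sigma> i = \<tau> i) \<Longrightarrow> cell \<sigma> n = cell \<tau> n"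
  by (induction n) auto

lemma intervals_cell:
  assumes "I \<in> moran_intervals a b n"
  obtains \<sigma> where "I = cell \<sigma> n"
proof -
  have "\<exists>\<sigma>. I = cell \<sigma> n"
    using assms
  proof (induction n arbitrary: I)
    case (Suc n)
    then obtain J where J: "J \<in> moran_intervals a b n"
      "I = left_child (a (Suc n)) J \<or> I = right_child (b (Suc n)) J" by auto
    with Suc.IH obtain \<sigma> where \<sigma>: "J = cell \<sigma> n" by blast
    have "cell (\<sigma>(Suc n := c)) n = cell \<sigma> n" for c by (rule cell_cong) auto
    hence "I = cell (\<sigma>(Suc n := (I = left_child (a (Suc n)) J))) (Suc n)" using J(2) \<sigma> by auto
    thus ?case by blast
  qed simp
  thus thesis using that by blast
qed

lemma cell_length: "snd (cell \<sigma> n) - fst (cell \<sigma> n) = len \<sigma> n"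
  by (induction n) (auto simp: len_Suc ratio_def left_child_def right_child_def)

lemma cell_Suc_subset: "interval_set (cell \<sigma> (Suc n)) \<subseteq> interval_set (cell \<sigma> n)"
proof -
  have "0 \<le> ratio \<sigma> (Suc n) * len \<sigma> n" "ratio \<sigma> (Suc n) * len \<sigma> n \<le> 1 * len \<sigma> n"
    using len_pos[of \<sigma> n] ratio_pos[of "Suc n" \<sigma>] ratio_less[of "Suc n" \<sigma>]
    by (auto intro!: mult_right_mono)
  thus ?thesis using cell_length[of \<sigma> n]
    by (auto simp: left_child_def right_child_def ratio_def split: if_splits)
qed

lemma cell_subset: "N \<le> M \<Longrightarrow> interval_set (cell \<sigma> M) \<subseteq> interval_set (cell \<sigma> N)"
  using lift_Suc_antimono_le[of "\<lambda>n. interval_set (cell \<sigma> n)"] cell_Suc_subset by blast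

text \<open>The gap between the two children of an interval of length \<open>l\<close> is \<open>(1 - a - b) l \<ge> (1 - B) l\<close>.\<close>

lemma cell_separation:
  assumes eq: "cell \<sigma> n = cell \<tau> n" and "\<sigma> (Suc n) \<noteq> \<tau> (Suc n)"
    and x: "x \<in> interval_set (cell \<sigma> (Suc n))" and y: "y \<in> interval_set (cell \<tau> (Suc n))"
  shows "(1 - B) * len \<sigma> n \<le> \<bar>x - y\<bar>"
proof -
  have "(a (Suc n) + b (Suc n)) * len \<sigma> n \<le> B * len \<sigma> n"
    using ab_le[of "Suc n"] len_pos[of \<sigma> n] by (intro mult_right_mono) auto
  thus ?thesis
    using x y assms(2) cell_length[of \<sigma> n] cell_length[of \<tau> n] unfolding eq[symmetric]
    by (cases "\<sigma> (Suc n)")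
       (auto simp: left_child_def right_child_def algebra_simps eq[symmetric])
qed

text \<open>Points closer than all gaps up to a step have not been separated before that step.\<close>

lemma close_points_agree:
  assumes "x \<in> interval_set (cell \<sigma> N)" "y \<in> interval_set (cell \<tau> N)"
    and "\<And>n. n < N \<Longrightarrow> \<bar>x - y\<bar> < (1 - B) * len \<sigma> n"
  shows "\<forall>i\<in>{0<..N}. \<sigma> i = \<tau> i"
  using assms
proof (induction N)
  case (Suc N)
  have IH: "\<forall>i\<in>{0<..N}. \<sigma> i = \<tau> i"
    using Suc.prems cell_Suc_subset by (intro Suc.IH) (blast, blast, simp)
  have "\<sigma> (Suc N) = \<tau> (Suc N)"
  proof (rule ccontr)
    assume *: "\<sigma> (Suc N) \<noteq> \<tau> (Suc N)"
    have "cell \<sigma> N = cell \<tau> N" using IH by (intro cell_cong) auto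
    from cell_separation[OF this * Suc.prems(1,2)] Suc.prems(3)[of N] show False by simp
  qed
  with IH show ?case by (auto simp: greaterThanAtMost_Suc)
qed simp

section \<open>Masses of balls\<close>

definition codes :: "(nat \<Rightarrow> bool) \<Rightarrow> real \<Rightarrow> bool" where
  "codes \<sigma> x \<longleftrightarrow> (\<forall>n. x \<in> interval_set (cell \<sigma> n))"

text \<open>At each step some interval contains \<open>x\<close>; by separation the paths to these intervals agree
  where they overlap, so the diagonal path passes through all of them.\<close>

lemma moran_set_code:
  assumes "x \<in> moran_set a b"
  obtains \<sigma> where "codes \<sigma> x"
proof -
  have "\<exists>\<sigma>. x \<in> interval_set (cell \<sigma> n)" for n
  proof -
    obtain I where I: "I \<in> moran_intervals a b n" "x \<in> interval_set I"
      using assms unfolding moran_set_def INT_iff UN_iff by (meson UNIV_I)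
    obtain \<sigma> where "I = cell \<sigma> n" using intervals_cell[OF I(1)] .
    with I(2) show ?thesis by blast
  qed
  hence "\<exists>s. \<forall>n. x \<in> interval_set (cell (s n) n)" by (intro choice allI)
  then obtain s where s: "\<And>n. x \<in> interval_set (cell (s n) n)" by blast
  have agree: "\<forall>i\<in>{0<..N}. s N i = s M i" if "N \<le> M" for N M
  proof (rule close_points_agree)
    show "x \<in> interval_set (cell (s N) N)" by (rule s)
    show "x \<in> interval_set (cell (s M) N)" by (rule subsetD[OF cell_subset[OF that] s])
    show "\<bar>x - x\<bar> < (1 - B) * len (s N) n" for n using B_less len_pos[of "s N" n] by simp
  qed
  have "cell (\<lambda>n. s n n) n = cell (s n) n" for n
    using agree by (intro cell_cong) auto
  hence "codes (\<lambda>n. s n n) x" unfolding codes_def using s by presburger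
  thus thesis by (rule that)
qed

lemma prob_mu: "prob_space \<mu>" and sets_mu: "sets \<mu> = sets borel"
  and mu_moran_set: "measure \<mu> (moran_set a b) = 1"
  using moran by (auto simp: moran_measure_def)

lemma closed_sets_mu: "closed S \<Longrightarrow> S \<in> sets \<mu>" and open_sets_mu: "open S \<Longrightarrow> S \<in> sets \<mu>"
  by (simp_all add: sets_mu)

lemma finite_mu: "finite_measure \<mu>"
  using prob_mu by (simp add: prob_space_def)

lemma measure_mu_mono: "S \<subseteq> T \<Longrightarrow> T \<in> sets \<mu> \<Longrightarrow> measure \<mu> S \<le> measure \<mu> T"
  by (rule finite_measure.finite_measure_mono[OF finite_mu])

lemma closed_moran_set: "closed (moran_set a b)"
proof -
  have "finite (moran_intervals a b n)" for n by (induction n) auto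
  thus ?thesis unfolding moran_set_def by (intro closed_INT ballI closed_UN) auto
qed

lemma measure_cell: "measure \<mu> (interval_set (cell \<sigma> n)) = mass \<sigma> n"
proof (induction n)
  case 0
  show ?case using moran by (simp add: moran_measure_def)
next
  case (Suc n)
  show ?case using moran cell_in_intervals[of \<sigma> n] Suc
    by (auto simp: moran_measure_def mass_Suc weight_def)
qed

lemma mass_le_ball:
  assumes "codes \<sigma> x" "len \<sigma> n < r"
  shows "mass \<sigma> n \<le> measure \<mu> (ball x r)"
proof -
  have "interval_set (cell \<sigma> n) \<subseteq> ball x r"
  proof
    fix y assume "y \<in> interval_set (cell \<sigma> n)"
    moreover have "x \<in> interval_set (cell \<sigma> n)" using assms(1) by (simp add: codes_def)
    ultimately have "\<bar>x - y\<bar> < r" using assms(2) cell_length[of \<sigma> n] by auto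
    thus "y \<in> ball x r" by (simp add: dist_real_def)
  qed
  hence "measure \<mu> (interval_set (cell \<sigma> n)) \<le> measure \<mu> (ball x r)"
    by (intro measure_mu_mono open_sets_mu) auto
  thus ?thesis by (simp add: measure_cell)
qed

text \<open>Within the Moran set, a ball that is smaller than the gaps met so far cannot leave the current
  interval; the rest of the ball has measure \<open>0\<close>.\<close>

lemma ball_le_mass:
  assumes "codes \<sigma> x" "\<And>n. n < N \<Longrightarrow> r \<le> (1 - B) * len \<sigma> n"
  shows "measure \<mu> (ball x r) \<le> mass \<sigma> N"
proof -
  interpret prob_space \<mu> by (rule prob_mu)
  have C: "moran_set a b \<in> events" by (intro closed_sets_mu closed_moran_set)
  have "ball x r \<inter> moran_set a b \<subseteq> interval_set (cell \<sigma> N)"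
  proof safe
    fix y assume y: "y \<in> ball x r" "y \<in> moran_set a b"
    obtain \<tau> where \<tau>: "codes \<tau> y" using moran_set_code[OF y(2)] .
    have "\<forall>i\<in>{0<..N}. \<sigma> i = \<tau> i"
      using assms(1) \<tau> y(1) by (intro close_points_agree[of x _ _ y])
        (auto simp: codes_def dist_real_def intro: less_le_trans[OF _ assms(2)])
    hence "cell \<sigma> N = cell \<tau> N" by (intro cell_cong) auto
    thus "y \<in> interval_set (cell \<sigma> N)" using \<tau> by (simp add: codes_def)
  qed
  hence "prob (ball x r \<inter> moran_set a b) \<le> mass \<sigma> N"
    unfolding measure_cell[symmetric] by (intro measure_mu_mono closed_sets_mu) auto
  moreover have "prob (ball x r) = prob (ball x r \<inter> moran_set a b)"
    using C open_sets_mu[OF open_ball] mu_moran_set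
    by (intro finite_measure_eq_AE) (auto simp: prob_eq_1)
  ultimately show ?thesis by simp
qed

lemma support_code:
  assumes "x \<in> measure_support \<mu>"
  obtains \<sigma> where "codes \<sigma> x"
proof (rule moran_set_code)
  interpret prob_space \<mu> by (rule prob_mu)
  show "x \<in> moran_set a b"
  proof (rule ccontr)
    assume *: "x \<notin> moran_set a b"
    have "space \<mu> = UNIV" using sets_eq_imp_space_eq[OF sets_mu] by simp
    hence "emeasure \<mu> (- moran_set a b) = 0"
      using prob_compl[OF closed_sets_mu[OF closed_moran_set]] mu_moran_set
      by (simp add: emeasure_eq_measure Compl_eq_Diff_UNIV)
    moreover have "open (- moran_set a b)" using closed_moran_set by auto
    ultimately show False using assms * by (auto simp: measure_support_def)
  qed
qed

lemma code_support:
  assumes "codes \<sigma> x"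
  shows "x \<in> measure_support \<mu>"
  unfolding measure_support_def
proof (intro CollectI allI impI)
  interpret prob_space \<mu> by (rule prob_mu)
  fix U assume U: "open U \<and> x \<in> U"
  then obtain r where r: "0 < r" "ball x r \<subseteq> U" by (meson openE)
  obtain n where "len \<sigma> n < r" using first_len_less[OF r(1)] .
  hence "0 < prob (ball x r)" using mass_le_ball[OF assms] mass_pos less_le_trans by blast
  also have "\<dots> \<le> prob U" using r U by (intro measure_mu_mono open_sets_mu) auto
  finally show "0 < emeasure \<mu> U" by (simp add: emeasure_eq_measure)
qed

text \<open>Take the first step at which the gap falls below \<open>r\<close>.\<close>

lemma ball_approx_above:
  assumes "codes \<sigma> x" "0 < r"
  obtains N where "(1 - B) * len \<sigma> N < r" "measure \<mu> (ball x r) \<le> mass \<sigma> N"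
proof -
  obtain N where N: "len \<sigma> N < r / (1 - B)" "\<And>n. n < N \<Longrightarrow> r / (1 - B) \<le> len \<sigma> n"
    using first_len_less[of "r / (1 - B)" \<sigma>] assms B_less by auto
  show thesis
    using N B_less assms by (intro that[of N] ball_le_mass) (auto simp: field_simps)
qed

text \<open>Take the first step at which the interval is shorter than \<open>r\<close>. Its parent is not, and \<open>r \<le> 1\<close>
  guarantees that there is a parent.\<close>

lemma ball_approx_below:
  assumes "codes \<sigma> x" "0 < r" "r \<le> 1"
  obtains N where "A * r \<le> len \<sigma> N" "mass \<sigma> N \<le> measure \<mu> (ball x r)"
proof -
  obtain N where N: "len \<sigma> N < r" "\<And>n. n < N \<Longrightarrow> r \<le> len \<sigma> n"
    using first_len_less[OF assms(2), of \<sigma>] by auto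
  with assms(3) have "N \<noteq> 0" by (intro notI) simp
  then obtain k where k: "N = Suc k" by (cases N) auto
  have "r * A \<le> len \<sigma> k * ratio \<sigma> (Suc k)"
    using N(2)[of k] k assms(2) A_pos ratio_bounds[of "Suc k" \<sigma>] len_pos[of \<sigma> k]
    by (intro mult_mono) (auto simp: less_imp_le)
  thus thesis using N k mass_le_ball[OF assms(1)]
    by (intro that[of N]) (auto simp: len_Suc mult.commute)
qed

lemma ball_pos: "codes \<sigma> x \<Longrightarrow> 0 < r \<Longrightarrow> 0 < measure \<mu> (ball x r)"
  by (meson first_len_less less_le_trans mass_le_ball mass_pos)

section \<open>Exponents that hold at all scales\<close>

text \<open>Replace the larger ball by the interval of step \<open>N\<close> and the smaller one by that of step \<open>M\<close>,
  from outside and inside respectively, and compare factors between the two steps. When \<open>M < N\<close>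
  the quotient of masses is at most \<open>1\<close> and the constant \<open>C\<close> absorbs it.\<close>

lemma upper_exponentI:
  assumes d: "0 \<le> d" and "\<And>\<sigma> n. 1 \<le> n \<Longrightarrow> ratio \<sigma> n powr d \<le> weight \<sigma> n"
  shows "upper_exponent \<Phi> \<mu> d"
  unfolding upper_exponent_def
proof (intro exI conjI ballI allI impI)
  define C where "C = (1 / (A * (1 - B))) powr d"
  show "(0::real) < 1" "0 < C" using A_pos B_less by (auto simp: C_def)
  fix x r R assume x: "x \<in> measure_support \<mu>"
    and rR: "0 < r \<and> r < R powr (1 + \<Phi> R) \<and> R powr (1 + \<Phi> R) \<le> R \<and> R \<le> 1"
  hence rR': "0 < r" "r < R" "R \<le> 1" by auto
  have AB: "0 < A * (1 - B)" "A * (1 - B) \<le> 1"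
    using A_pos A_le_1 B_pos B_less by (auto intro!: mult_le_one)
  obtain \<sigma> where \<sigma>: "codes \<sigma> x" using support_code[OF x] .
  obtain N where N: "(1 - B) * len \<sigma> N < R" "measure \<mu> (ball x R) \<le> mass \<sigma> N"
    using ball_approx_above[OF \<sigma>, of R] rR' by auto
  obtain M where M: "A * r \<le> len \<sigma> M" "mass \<sigma> M \<le> measure \<mu> (ball x r)"
    using ball_approx_below[OF \<sigma>, of r] rR' by auto
  have "measure \<mu> (ball x R) / measure \<mu> (ball x r) \<le> mass \<sigma> N / mass \<sigma> M"
    using N M mass_pos[of \<sigma>] by (intro frac_le) (auto simp: less_imp_le)
  also have "\<dots> \<le> (R / (A * (1 - B) * r)) powr d"
  proof (cases "N \<le> M")
    case True
    have "mass \<sigma> N / mass \<sigma> M \<le> (len \<sigma> N / len \<sigma> M) powr d"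
      using True assms(2) by (intro mass_ratio_ge) auto
    also have "len \<sigma> N / len \<sigma> M \<le> (R / (1 - B)) / (A * r)"
      using N M rR' B_less A_pos len_pos[of \<sigma> N] by (intro frac_le) (auto simp: field_simps)
    hence "(len \<sigma> N / len \<sigma> M) powr d \<le> ((R / (1 - B)) / (A * r)) powr d"
      using d len_pos[of \<sigma>] by (intro powr_mono2) (auto simp: less_imp_le)
    finally show ?thesis by (simp add: mult_ac)
  next
    case False
    have "mass \<sigma> N / mass \<sigma> M \<le> 1"
      using False mass_antimono[of M N \<sigma>] mass_pos[of \<sigma> M] by simp
    also have "A * (1 - B) * r \<le> 1 * R" using AB rR' by (intro mult_mono) auto
    hence "1 \<le> (R / (A * (1 - B) * r)) powr d"
      using AB rR' d by (intro ge_one_powr_ge_zero) auto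
    finally show ?thesis .
  qed
  also have "\<dots> = C * (R / r) powr d"
    using AB rR' unfolding C_def by (subst powr_mult[symmetric]) auto
  finally show "measure \<mu> (ball x R) / measure \<mu> (ball x r) \<le> C * (R / r) powr d" .
qed

text \<open>As before with the roles of inside and outside exchanged. For \<open>d < 0\<close> the bound is trivial,
  since the larger ball contains the smaller one; for \<open>d \<ge> 0\<close> this also settles the case in which
  the steps of the two intervals come in the wrong order.\<close>

lemma lower_exponentI:
  assumes "\<And>\<sigma> n. 1 \<le> n \<Longrightarrow> weight \<sigma> n \<le> ratio \<sigma> n powr d"
  shows "lower_exponent \<Phi> \<mu> d"
  unfolding lower_exponent_def
proof (intro exI conjI ballI allI impI)
  define C where "C = (A * (1 - B)) powr max 0 d"
  have AB: "0 < A * (1 - B)" "A * (1 - B) \<le> 1"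
    using A_pos A_le_1 B_pos B_less by (auto intro!: mult_le_one)
  show "(0::real) < 1" "0 < C" using AB by (auto simp: C_def)
  fix x r R assume x: "x \<in> measure_support \<mu>"
    and rR: "0 < r \<and> r < R powr (1 + \<Phi> R) \<and> R powr (1 + \<Phi> R) \<le> R \<and> R \<le> 1"
  hence rR': "0 < r" "r < R" "R \<le> 1" by auto
  obtain \<sigma> where \<sigma>: "codes \<sigma> x" using support_code[OF x] .
  obtain N where N: "(1 - B) * len \<sigma> N < r" "measure \<mu> (ball x r) \<le> mass \<sigma> N"
    using ball_approx_above[OF \<sigma>, of r] rR' by auto
  obtain M where M: "A * R \<le> len \<sigma> M" "mass \<sigma> M \<le> measure \<mu> (ball x R)"
    using ball_approx_below[OF \<sigma>, of R] rR' by auto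
  have "measure \<mu> (ball x r) \<le> measure \<mu> (ball x R)"
    using rR' by (intro measure_mu_mono open_sets_mu) auto
  hence ge_1: "1 \<le> measure \<mu> (ball x R) / measure \<mu> (ball x r)"
    using ball_pos[OF \<sigma> rR'(1)] by simp
  show "C * (R / r) powr d \<le> measure \<mu> (ball x R) / measure \<mu> (ball x r)"
  proof (cases "0 \<le> d")
    case False
    have "(R / r) powr d \<le> (R / r) powr 0" using False rR' by (intro powr_mono) auto
    thus ?thesis using False ge_1 rR' AB by (simp add: C_def)
  next
    case True
    have C: "C * (R / r) powr d = (A * (1 - B) * R / r) powr d"
      using powr_mult[of "A * (1 - B)" "R / r" d] AB rR' True by (simp add: C_def)
    have le: "A * (1 - B) * R / r \<le> len \<sigma> M / len \<sigma> N"
    proof -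
      have "(A * R) / (r / (1 - B)) \<le> len \<sigma> M / len \<sigma> N"
        using N M rR' B_less len_pos[of \<sigma>] by (intro frac_le) (auto simp: field_simps less_imp_le)
      thus ?thesis by (simp add: mult_ac)
    qed
    hence powr_le: "C * (R / r) powr d \<le> (len \<sigma> M / len \<sigma> N) powr d"
      unfolding C using AB rR' True by (intro powr_mono2) auto
    show ?thesis
    proof (cases "M \<le> N")
      case True
      note powr_le
      also have "(len \<sigma> M / len \<sigma> N) powr d \<le> mass \<sigma> M / mass \<sigma> N"
        using True assms by (intro mass_ratio_le) auto
      also have "\<dots> \<le> measure \<mu> (ball x R) / measure \<mu> (ball x r)"
        using N M ball_pos[OF \<sigma> rR'(1)] by (intro frac_le) auto
      finally show ?thesis .
    next
      case False
      have "len \<sigma> M / len \<sigma> N \<le> 1" using False len_antimono[of N M \<sigma>] len_pos[of \<sigma> N] by simp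
      hence "(len \<sigma> M / len \<sigma> N) powr d \<le> 1"
        using True len_pos[of \<sigma>] by (intro powr_le1) (auto simp: less_imp_le)
      with powr_le ge_1 show ?thesis by simp
    qed
  qed
qed

section \<open>Exponents that fail along long runs\<close>

text \<open>A run of \<open>c ln N\<close> steps shortens the interval by a factor of at least
  \<open>B * N\<^bsup>2 \<epsilon>\<^esup>\<close> with \<open>2 \<epsilon> = c ln (1/B)\<close>. On the other hand \<open>R = \<kappa> * len \<sigma> N\<close> satisfies
  \<open>|ln R| \<le> D * N\<close>, so by smallness of \<open>\<Phi>\<close> the eligible radii include all
  \<open>r < R * (D * N)\<^bsup>- \<epsilon>\<^esup>\<close>. The power \<open>N\<^bsup>\<epsilon>\<^esup>\<close> left over beats the constants \<open>\<kappa>\<close>, \<open>\<rho>\<close> and \<open>K\<close>. The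
  freedom in \<open>\<kappa>\<close> and \<open>\<rho>\<close> serves to choose balls that lie inside or outside given intervals.\<close>

lemma log_runs_scales:
  assumes runs: "log_runs E" and dim: "dimension_function \<Phi>" and small: "small \<Phi>"
    and pos: "0 < \<kappa>" "0 < \<rho>" "0 < C"
  obtains N M where "N \<le> M" "\<And>j. j \<in> {N<..M} \<Longrightarrow> E j" "K \<le> len \<sigma> N / len \<sigma> M"
    "\<rho> * len \<sigma> M < (\<kappa> * len \<sigma> N) powr (1 + \<Phi> (\<kappa> * len \<sigma> N))"
    "(\<kappa> * len \<sigma> N) powr (1 + \<Phi> (\<kappa> * len \<sigma> N)) \<le> \<kappa> * len \<sigma> N" "\<kappa> * len \<sigma> N \<le> C"
proof -
  obtain c where c: "c > 0" "\<exists>\<^sub>F N in sequentially. \<forall>j. N < j \<and> real j \<le> N + c * ln N \<longrightarrow> E j"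
    using runs unfolding log_runs_def by blast
  define \<epsilon> where "\<epsilon> = c * ln (1 / B) / 2"
  have \<epsilon>: "0 < \<epsilon>" using c(1) B_pos B_less by (simp add: \<epsilon>_def)
  define D where "D = \<bar>ln \<kappa>\<bar> - ln A"
  have ln_A: "ln A \<le> 0" using A_pos A_le_1 by simp
  have lim: "filterlim (\<lambda>N. \<kappa> * len \<sigma> N) (at_right 0) sequentially"
    using tendsto_mult_right_zero[OF len_tendsto[of \<sigma>], of \<kappa>] pos(1) len_pos
    by (intro tendsto_imp_filterlim_at_right) auto
  have "\<forall>\<^sub>F t in at_right 0. 0 < t \<and> t < min C 1"
    using eventually_at_right_real[of 0 "min C 1"] pos by simp
  note t_evs = eventually_compose_filterlim[OF this lim]
    eventually_compose_filterlim[OF small_powr_ge[OF small \<epsilon>] lim]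
  have N_ev1: "\<forall>\<^sub>F N in sequentially. \<rho> * D powr \<epsilon> / (\<kappa> * B) < real N powr \<epsilon>"
  proof -
    have "filterlim (\<lambda>N. real N powr \<epsilon>) at_top sequentially" using \<epsilon> by real_asymp
    thus ?thesis by (simp add: filterlim_at_top_dense)
  qed
  have N_ev2: "\<forall>\<^sub>F N in sequentially. K \<le> B * real N powr (2 * \<epsilon>)"
  proof -
    have "filterlim (\<lambda>N. B * real N powr (2 * \<epsilon>)) at_top sequentially" using \<epsilon> B_pos by real_asymp
    thus ?thesis by (simp add: filterlim_at_top)
  qed
  have "\<exists>N. (\<forall>j. N < j \<and> real j \<le> N + c * ln N \<longrightarrow> E j) \<and>
     (0 < \<kappa> * len \<sigma> N \<and> \<kappa> * len \<sigma> N < min C 1) \<and>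
     \<kappa> * len \<sigma> N * (- ln (\<kappa> * len \<sigma> N)) powr - \<epsilon> \<le> (\<kappa> * len \<sigma> N) powr (1 + \<Phi> (\<kappa> * len \<sigma> N)) \<and>
     \<rho> * D powr \<epsilon> / (\<kappa> * B) < real N powr \<epsilon> \<and> K \<le> B * real N powr (2 * \<epsilon>) \<and> 1 \<le> N"
    using frequently_ex[OF frequently_eventually_frequently[OF c(2)
      eventually_conj[OF t_evs(1) eventually_conj[OF t_evs(2) eventually_conj[OF N_ev1
        eventually_conj[OF N_ev2 eventually_ge_at_top[of 1]]]]]]] .
  then obtain N where runN: "\<And>j. N < j \<Longrightarrow> real j \<le> N + c * ln N \<Longrightarrow> E j"
    and t: "0 < \<kappa> * len \<sigma> N" "\<kappa> * len \<sigma> N < C" "\<kappa> * len \<sigma> N < 1"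
    and \<Psi>: "\<kappa> * len \<sigma> N * (- ln (\<kappa> * len \<sigma> N)) powr - \<epsilon> \<le> (\<kappa> * len \<sigma> N) powr (1 + \<Phi> (\<kappa> * len \<sigma> N))"
    and N1: "\<rho> * D powr \<epsilon> / (\<kappa> * B) < real N powr \<epsilon>" and N2: "K \<le> B * real N powr (2 * \<epsilon>)"
    and N: "1 \<le> N"
    by auto
  define M where "M = N + nat \<lfloor>c * ln (real N)\<rfloor>"
  have ln_N: "0 \<le> c * ln (real N)" using N c(1) by simp
  have Q_ge: "B * real N powr (2 * \<epsilon>) \<le> len \<sigma> N / len \<sigma> M"
  proof -
    \<comment> \<open>rounding \<open>c ln N\<close> down costs at most one factor \<open>B\<close>\<close>
    have "real N powr (2 * \<epsilon>) = (1 / B) powr (c * ln (real N))"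
      using N B_pos by (simp add: powr_def \<epsilon>_def mult_ac)
    hence "B * real N powr (2 * \<epsilon>) = (1 / B) powr (c * ln (real N) - 1)"
      using B_pos by (simp add: powr_diff)
    also have "\<dots> \<le> (1 / B) powr real (M - N)"
    proof (rule powr_mono)
      show "c * ln (real N) - 1 \<le> real (M - N)" using ln_N by (simp add: M_def)
      show "1 \<le> 1 / B" using B_pos B_less by simp
    qed
    also have "\<dots> = 1 / B ^ (M - N)" using B_pos by (simp add: powr_realpow power_one_over)
    also have "\<dots> \<le> len \<sigma> N / len \<sigma> M"
      using len_le[of N M \<sigma>] len_pos[of \<sigma>] B_pos by (simp add: M_def field_simps)
    finally show ?thesis .
  qed
  have ln_t: "0 < - ln (\<kappa> * len \<sigma> N)" using t by simp
  have "- ln (\<kappa> * len \<sigma> N) = - ln \<kappa> - ln (len \<sigma> N)"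
    using pos(1) len_pos[of \<sigma> N] by (simp add: ln_mult)
  also have "\<dots> \<le> - ln \<kappa> - ln (A ^ N)"
    using len_ge[of N \<sigma>] A_pos len_pos[of \<sigma> N] by simp
  also have "\<dots> = - ln \<kappa> - real N * ln A" using A_pos by (simp add: ln_realpow)
  also have "\<dots> \<le> D * N"
  proof -
    have "\<bar>ln \<kappa>\<bar> * 1 \<le> \<bar>ln \<kappa>\<bar> * real N" using N by (intro mult_left_mono) auto
    thus ?thesis by (simp add: D_def algebra_simps)
  qed
  finally have ln_le: "- ln (\<kappa> * len \<sigma> N) \<le> D * N" .
  with ln_t have DN: "0 < D * N" by linarith
  hence D: "0 < D" using N by (simp add: zero_less_mult_iff)
  have "\<rho> * len \<sigma> M < (\<kappa> * len \<sigma> N) powr (1 + \<Phi> (\<kappa> * len \<sigma> N))"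
  proof -
    have "\<rho> * (D * N) powr \<epsilon> = \<rho> * D powr \<epsilon> * real N powr \<epsilon>"
      using D by (simp add: powr_mult)
    also have "\<dots> < (\<kappa> * B * real N powr \<epsilon>) * real N powr \<epsilon>"
      using N1 N B_pos pos by (intro mult_strict_right_mono) (auto simp: field_simps)
    also have "\<dots> = \<kappa> * (B * real N powr (2 * \<epsilon>))"
      by (simp add: powr_add[symmetric])
    also have "\<dots> \<le> \<kappa> * (len \<sigma> N / len \<sigma> M)" using Q_ge pos by (intro mult_left_mono) auto
    finally have "\<rho> * len \<sigma> M * (D * N) powr \<epsilon> < \<kappa> * len \<sigma> N"
      using len_pos[of \<sigma> M] by (simp add: field_simps)
    moreover have "0 < (D * N) powr \<epsilon>" using D N by simp
    ultimately have "\<rho> * len \<sigma> M < \<kappa> * len \<sigma> N * (D * N) powr - \<epsilon>"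
      by (simp only: powr_minus_divide times_divide_eq_right mult_1_right pos_less_divide_eq)
    also have "(D * N) powr - \<epsilon> \<le> (- ln (\<kappa> * len \<sigma> N)) powr - \<epsilon>"
      using ln_le ln_t \<epsilon> by (intro powr_mono2') auto
    hence "\<kappa> * len \<sigma> N * (D * N) powr - \<epsilon> \<le> \<kappa> * len \<sigma> N * (- ln (\<kappa> * len \<sigma> N)) powr - \<epsilon>"
      using t by (intro mult_left_mono) auto
    also note \<Psi>
    finally show ?thesis .
  qed
  moreover have "(\<kappa> * len \<sigma> N) powr (1 + \<Phi> (\<kappa> * len \<sigma> N)) \<le> \<kappa> * len \<sigma> N"
  proof -
    have "0 \<le> \<Phi> (\<kappa> * len \<sigma> N)" using dim t by (auto simp: dimension_function_def)
    hence "(\<kappa> * len \<sigma> N) powr (1 + \<Phi> (\<kappa> * len \<sigma> N)) \<le> (\<kappa> * len \<sigma> N) powr 1"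
      using t by (intro powr_mono') auto
    thus ?thesis using t by simp
  qed
  moreover have "E j" if "j \<in> {N<..M}" for j
  proof (rule runN)
    have "real j \<le> real M" using that by simp
    also have "\<dots> \<le> N + c * ln N" using ln_N by (simp add: M_def)
    finally show "real j \<le> N + c * ln N" .
  qed (use that in simp)
  ultimately show thesis
    using Q_ge N2 t by (intro that[of N M]) (auto simp: M_def)
qed

text \<open>The ball of radius \<open>2 * len \<sigma> N\<close> contains the interval of step \<open>N\<close>, and within the Moran set
  the ball of radius \<open>(1 - B) * len \<sigma> M\<close> stays in that of step \<open>M\<close>. The run between the two steps
  forces the quotient of masses above the power \<open>d'\<close> of the quotient of lengths, which eventually
  exceeds every constant multiple of its power \<open>d\<close>.\<close>

lemma not_upper_exponent:
  assumes "codes \<sigma> x" and runs: "log_runs (\<lambda>n. weight \<sigma> n \<le> ratio \<sigma> n powr d')"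
    and "d < d'" "dimension_function \<Phi>" "small \<Phi>"
  shows "\<not> upper_exponent \<Phi> \<mu> d"
proof
  assume "upper_exponent \<Phi> \<mu> d"
  then obtain C\<^sub>1 C\<^sub>2 where C: "0 < C\<^sub>1" "0 < C\<^sub>2" and le: "\<And>r R. 0 < r \<Longrightarrow> r < R powr (1 + \<Phi> R) \<Longrightarrow>
    R powr (1 + \<Phi> R) \<le> R \<Longrightarrow> R \<le> C\<^sub>1 \<Longrightarrow> measure \<mu> (ball x R) / measure \<mu> (ball x r) \<le> C\<^sub>2 * (R / r) powr d"
    unfolding upper_exponent_def using code_support[OF assms(1)] by blast
  obtain K where K: "\<And>Q. K \<le> Q \<Longrightarrow> C\<^sub>2 * (2 / (1 - B)) powr d * Q powr d < Q powr d'"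
    using powr_dominates[OF \<open>d < d'\<close>] by blast
  obtain N M where NM: "N \<le> M" "\<And>j. j \<in> {N<..M} \<Longrightarrow> weight \<sigma> j \<le> ratio \<sigma> j powr d'"
    "K \<le> len \<sigma> N / len \<sigma> M"
    "(1 - B) * len \<sigma> M < (2 * len \<sigma> N) powr (1 + \<Phi> (2 * len \<sigma> N))"
    "(2 * len \<sigma> N) powr (1 + \<Phi> (2 * len \<sigma> N)) \<le> 2 * len \<sigma> N" "2 * len \<sigma> N \<le> C\<^sub>1"
    using log_runs_scales[OF runs assms(4,5), of 2 "1 - B" C\<^sub>1 K \<sigma>] B_less C(1) by auto
  let ?Q = "len \<sigma> N / len \<sigma> M"
  have "?Q powr d' \<le> mass \<sigma> N / mass \<sigma> M" by (rule mass_ratio_le[OF NM(1,2)])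
  also have "\<dots> \<le> measure \<mu> (ball x (2 * len \<sigma> N)) / measure \<mu> (ball x ((1 - B) * len \<sigma> M))"
  proof (rule frac_le)
    show "mass \<sigma> N \<le> measure \<mu> (ball x (2 * len \<sigma> N))"
      using len_pos[of \<sigma> N] by (intro mass_le_ball[OF assms(1)]) simp
    show "measure \<mu> (ball x ((1 - B) * len \<sigma> M)) \<le> mass \<sigma> M"
      using B_less len_antimono by (intro ball_le_mass[OF assms(1)] mult_left_mono) auto
    show "0 < measure \<mu> (ball x ((1 - B) * len \<sigma> M))"
      using B_less len_pos by (intro ball_pos[OF assms(1)]) auto
  qed simp
  also have "\<dots> \<le> C\<^sub>2 * ((2 * len \<sigma> N) / ((1 - B) * len \<sigma> M)) powr d"
    using B_less len_pos[of \<sigma> M] by (intro le NM) auto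
  also have "(2 * len \<sigma> N) / ((1 - B) * len \<sigma> M) = (2 / (1 - B)) * ?Q" by simp
  also have "\<dots> powr d = (2 / (1 - B)) powr d * ?Q powr d"
    using B_less len_pos[of \<sigma>] by (intro powr_mult)
  finally show False using K[OF NM(3)] by (simp add: mult_ac)
qed

text \<open>Now the larger ball is taken small enough to stay in the interval of step \<open>N\<close> and the smaller
  one large enough to contain that of step \<open>M\<close>.\<close>

lemma not_lower_exponent:
  assumes "codes \<sigma> x" and runs: "log_runs (\<lambda>n. ratio \<sigma> n powr d' \<le> weight \<sigma> n)"
    and "d' < d" "dimension_function \<Phi>" "small \<Phi>"
  shows "\<not> lower_exponent \<Phi> \<mu> d"
proof
  assume "lower_exponent \<Phi> \<mu> d"
  then obtain C\<^sub>1 C\<^sub>2 where C: "0 < C\<^sub>1" "0 < C\<^sub>2" and le: "\<And>r R. 0 < r \<Longrightarrow> r < R powr (1 + \<Phi> R) \<Longrightarrow>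
    R powr (1 + \<Phi> R) \<le> R \<Longrightarrow> R \<le> C\<^sub>1 \<Longrightarrow> C\<^sub>2 * (R / r) powr d \<le> measure \<mu> (ball x R) / measure \<mu> (ball x r)"
    unfolding lower_exponent_def using code_support[OF assms(1)] by blast
  define D where "D = C\<^sub>2 * ((1 - B) / 2) powr d"
  have D: "0 < D" using C B_less by (simp add: D_def)
  obtain K where K: "\<And>Q. K \<le> Q \<Longrightarrow> 1 / D * Q powr d' < Q powr d"
    using powr_dominates[OF \<open>d' < d\<close>] by blast
  obtain N M where NM: "N \<le> M" "\<And>j. j \<in> {N<..M} \<Longrightarrow> ratio \<sigma> j powr d' \<le> weight \<sigma> j"
    "K \<le> len \<sigma> N / len \<sigma> M"
    "2 * len \<sigma> M < ((1 - B) * len \<sigma> N) powr (1 + \<Phi> ((1 - B) * len \<sigma> N))"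
    "((1 - B) * len \<sigma> N) powr (1 + \<Phi> ((1 - B) * len \<sigma> N)) \<le> (1 - B) * len \<sigma> N"
    "(1 - B) * len \<sigma> N \<le> C\<^sub>1"
    using log_runs_scales[OF runs assms(4,5), of "1 - B" 2 C\<^sub>1 K \<sigma>] B_less C(1) by auto
  let ?Q = "len \<sigma> N / len \<sigma> M"
  have "D * ?Q powr d = C\<^sub>2 * (((1 - B) / 2) * ?Q) powr d"
    unfolding D_def by (subst powr_mult) simp
  also have "\<dots> = C\<^sub>2 * (((1 - B) * len \<sigma> N) / (2 * len \<sigma> M)) powr d" by simp
  also have "\<dots> \<le> measure \<mu> (ball x ((1 - B) * len \<sigma> N)) / measure \<mu> (ball x (2 * len \<sigma> M))"
    using len_pos[of \<sigma> M] by (intro le NM) auto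
  also have "\<dots> \<le> mass \<sigma> N / mass \<sigma> M"
  proof (rule frac_le)
    show "measure \<mu> (ball x ((1 - B) * len \<sigma> N)) \<le> mass \<sigma> N"
      using B_less len_antimono by (intro ball_le_mass[OF assms(1)] mult_left_mono) auto
    show "mass \<sigma> M \<le> measure \<mu> (ball x (2 * len \<sigma> M))"
      using len_pos[of \<sigma> M] by (intro mass_le_ball[OF assms(1)]) simp
  qed (use mass_pos less_imp_le in auto)
  also have "\<dots> \<le> ?Q powr d'" by (rule mass_ratio_ge[OF NM(1,2)])
  finally show False using K[OF NM(3)] D by (simp add: field_simps)
qed

section \<open>Dimensions from local exponents\<close>

definition local_exponent :: "(nat \<Rightarrow> bool) \<Rightarrow> nat \<Rightarrow> real" where
  "local_exponent \<sigma> n = ln (weight \<sigma> n) / ln (ratio \<sigma> n)"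

text \<open>The relation reverses because \<open>ln (ratio \<sigma> n)\<close> is negative.\<close>

lemma weight_le_iff: "weight \<sigma> n \<le> ratio \<sigma> n powr d \<longleftrightarrow> d \<le> local_exponent \<sigma> n"
  and weight_ge_iff: "ratio \<sigma> n powr d \<le> weight \<sigma> n \<longleftrightarrow> local_exponent \<sigma> n \<le> d" if "1 \<le> n"
proof -
  have r: "0 < ratio \<sigma> n" "ln (ratio \<sigma> n) < 0" and w: "0 < weight \<sigma> n"
    using ratio_pos[OF that, of \<sigma>] ratio_less[OF that, of \<sigma>] weight_pos[OF that, of \<sigma>] by auto
  have "weight \<sigma> n \<le> ratio \<sigma> n powr d \<longleftrightarrow> ln (weight \<sigma> n) \<le> ln (ratio \<sigma> n powr d)"
    using r w by (intro ln_le_cancel_iff[symmetric]) auto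
  thus "weight \<sigma> n \<le> ratio \<sigma> n powr d \<longleftrightarrow> d \<le> local_exponent \<sigma> n"
    using r by (simp add: local_exponent_def ln_powr neg_le_divide_eq)
  have "ratio \<sigma> n powr d \<le> weight \<sigma> n \<longleftrightarrow> ln (ratio \<sigma> n powr d) \<le> ln (weight \<sigma> n)"
    using r w by (intro ln_le_cancel_iff[symmetric]) auto
  thus "ratio \<sigma> n powr d \<le> weight \<sigma> n \<longleftrightarrow> local_exponent \<sigma> n \<le> d"
    using r by (simp add: local_exponent_def ln_powr neg_divide_le_eq)
qed

lemma local_exponent_pos: "1 \<le> n \<Longrightarrow> 0 < local_exponent \<sigma> n"
  using weight_pos[of n \<sigma>] weight_less[of n \<sigma>] ratio_pos[of n \<sigma>] ratio_less[of n \<sigma>]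
  unfolding local_exponent_def by (intro divide_neg_neg) auto

text \<open>Constant paths realise runs of one kind of local exponent at a point that depends neither on the
  position of the run nor on the realisation.\<close>

lemma constant_code: "codes (\<lambda>_. c) (if c then 0 else 1)"
proof -
  have "cell (\<lambda>_. True) n = (0, len (\<lambda>_. True) n)" for n
    by (induction n) (auto simp: left_child_def len_Suc ratio_def)
  moreover have "cell (\<lambda>_. False) n = (1 - len (\<lambda>_. False) n, 1)" for n
    by (induction n) (auto simp: right_child_def len_Suc ratio_def)
  ultimately show ?thesis using len_pos[THEN less_imp_le] by (auto simp: codes_def)
qed

lemma upper_dim_eq:
  assumes dim: "dimension_function \<Phi>" "small \<Phi>"
    and bound: "\<And>\<sigma> n. 1 \<le> n \<Longrightarrow> ereal (local_exponent \<sigma> n) \<le> \<alpha>"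
    and runs: "\<And>d. ereal d < \<alpha> \<Longrightarrow> \<exists>c. log_runs (\<lambda>n. d < local_exponent (\<lambda>_. c) n)"
  shows "upper_dim \<Phi> \<mu> = \<alpha>"
proof (rule upper_dim_eqI)
  fix d assume d: "\<alpha> < ereal d"
  have le: "local_exponent \<sigma> n \<le> d" if "1 \<le> n" for \<sigma> n
    using le_less_trans[OF bound[OF that] d] by (simp add: less_imp_le)
  have "0 \<le> d" using le[of 1 undefined] local_exponent_pos[of 1 undefined] by simp
  thus "upper_exponent \<Phi> \<mu> d" using le by (intro upper_exponentI) (simp_all add: weight_ge_iff)
next
  fix d assume "ereal d < \<alpha>"
  then obtain d' where d': "d < d'" "ereal d' < \<alpha>" using ereal_dense2[of "ereal d" \<alpha>] by auto
  obtain c where "log_runs (\<lambda>n. d' < local_exponent (\<lambda>_. c) n)" using runs[OF d'(2)] by blast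
  hence "log_runs (\<lambda>n. weight (\<lambda>_. c) n \<le> ratio (\<lambda>_. c) n powr d')"
    by (rule log_runs_mono) (simp add: weight_le_iff)
  thus "\<not> upper_exponent \<Phi> \<mu> d" by (rule not_upper_exponent[OF constant_code _ d'(1) dim])
qed

lemma lower_dim_eq:
  assumes dim: "dimension_function \<Phi>" "small \<Phi>"
    and bound: "\<And>\<sigma> n. 1 \<le> n \<Longrightarrow> \<beta> \<le> ereal (local_exponent \<sigma> n)"
    and runs: "\<And>d. \<beta> < ereal d \<Longrightarrow> \<exists>c. log_runs (\<lambda>n. local_exponent (\<lambda>_. c) n < d)"
  shows "lower_dim \<Phi> \<mu> = \<beta>"
proof (rule lower_dim_eqI)
  fix d assume d: "ereal d < \<beta>"
  have "d \<le> local_exponent \<sigma> n" if "1 \<le> n" for \<sigma> n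
    using less_le_trans[OF d bound[OF that]] by (simp add: less_imp_le)
  thus "lower_exponent \<Phi> \<mu> d" by (intro lower_exponentI) (simp add: weight_le_iff)
next
  fix d assume "\<beta> < ereal d"
  then obtain d' where d': "d' < d" "\<beta> < ereal d'" using ereal_dense2[of \<beta> "ereal d"] by auto
  obtain c where "log_runs (\<lambda>n. local_exponent (\<lambda>_. c) n < d')" using runs[OF d'(2)] by blast
  hence "log_runs (\<lambda>n. ratio (\<lambda>_. c) n powr d' \<le> weight (\<lambda>_. c) n)"
    by (rule log_runs_mono) (simp add: weight_ge_iff)
  thus "\<not> lower_exponent \<Phi> \<mu> d" by (rule not_lower_exponent[OF constant_code _ d'(1) dim])
qed

end

section \<open>Random Moran measures\<close>

text \<open>In the extended nonnegative reals \<open>inverse 0 = \<infinity>\<close>, so a finite integral rules out \<open>f = 0\<close> up to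
  a null set.\<close>

lemma (in prob_space) AE_pos_of_inverse_moment:
  fixes f :: "'a \<Rightarrow> real"
  assumes [measurable]: "f \<in> borel_measurable M" and nonneg: "\<And>\<omega>. \<omega> \<in> space M \<Longrightarrow> 0 \<le> f \<omega>"
    and "(\<integral>\<^sup>+\<omega>. inverse (ennreal (f \<omega> powr t)) \<partial>M) < \<infinity>"
  shows "AE \<omega> in M. 0 < f \<omega>"
proof -
  have "AE \<omega> in M. inverse (ennreal (f \<omega> powr t)) \<noteq> \<infinity>"
    using assms(3) by (intro nn_integral_PInf_AE) auto
  with AE_space show ?thesis
  proof eventually_elim
    case (elim \<omega>)
    have "f \<omega> \<noteq> 0" using elim(2) by auto
    with nonneg[OF elim(1)] show ?case by simp
  qed
qed

theorem theorem3:
  fixes M :: "'w measure" and A B :: real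
    and a b p :: "nat \<Rightarrow> 'w \<Rightarrow> real"
    and \<mu> :: "'w \<Rightarrow> real measure"
    and \<alpha> \<beta> :: ereal
  assumes "prob_space M"
    and "0 < 2 * A" and "2 * A \<le> B" and "B < 1"
    and range: "\<And>n \<omega>. n \<ge> 1 \<Longrightarrow> \<omega> \<in> space M \<Longrightarrow>
      (a n \<omega>, b n \<omega>, p n \<omega>) \<in> moran_parameters A B"
    and indep: "prob_space.indep_vars M (\<lambda>_. borel) (\<lambda>n \<omega>. (a n \<omega>, b n \<omega>, p n \<omega>)) {1..}"
    and ident: "\<And>n. n \<ge> 1 \<Longrightarrow>
      distr M borel (\<lambda>\<omega>. (a n \<omega>, b n \<omega>, p n \<omega>)) = distr M borel (\<lambda>\<omega>. (a 1 \<omega>, b 1 \<omega>, p 1 \<omega>))"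
    (* inverse 0 = \<infinity> in ennreal, so an atom of p n at 0 or 1 makes the integral infinite *)
    and moments: "\<exists>t>0. \<forall>n\<ge>1.
      (\<integral>\<^sup>+\<omega>. inverse (ennreal (p n \<omega> powr t)) \<partial>M) < \<infinity> \<and>
      (\<integral>\<^sup>+\<omega>. inverse (ennreal ((1 - p n \<omega>) powr t)) \<partial>M) < \<infinity>"
    and mu: "\<And>\<omega>. \<omega> \<in> space M \<Longrightarrow>
      moran_measure (\<lambda>n. a n \<omega>) (\<lambda>n. b n \<omega>) (\<lambda>n. p n \<omega>) (\<mu> \<omega>)"
  defines "\<alpha> \<equiv> max (esssup M (\<lambda>\<omega>. ereal (ln (p 1 \<omega>) / ln (a 1 \<omega>))))
                   (esssup M (\<lambda>\<omega>. ereal (ln (1 - p 1 \<omega>) / ln (b 1 \<omega>))))"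
    and "\<beta> \<equiv> min (essinf M (\<lambda>\<omega>. ereal (ln (p 1 \<omega>) / ln (a 1 \<omega>))))
                   (essinf M (\<lambda>\<omega>. ereal (ln (1 - p 1 \<omega>) / ln (b 1 \<omega>))))"
  shows "\<exists>\<Gamma>\<in>sets M. measure M \<Gamma> = 1 \<and>
    (\<forall>\<omega>\<in>\<Gamma>. \<forall>\<Phi>. dimension_function \<Phi> \<and> small \<Phi> \<longrightarrow>
       upper_dim \<Phi> (\<mu> \<omega>) = \<alpha> \<and> lower_dim \<Phi> (\<mu> \<omega>) = \<beta>)"
proof -
  interpret prob_space M by fact
  define X where "X n \<omega> = (a n \<omega>, b n \<omega>, p n \<omega>)" for n \<omega>
  have indep_X: "indep_vars (\<lambda>_. borel) X {1..}" using indep by (simp add: X_def[abs_def])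
  have ident_X: "distr M borel (X n) = distr M borel (X 1)" if "1 \<le> n" for n
    using ident[OF that] by (simp add: X_def[abs_def])
  have rv: "X n \<in> M \<rightarrow>\<^sub>M borel" if "1 \<le> n" for n
    using indep_X that by (auto simp: indep_vars_def)
  \<comment> \<open>\<open>h True\<close> and \<open>h False\<close> are the local exponents of left and right turns\<close>
  define h :: "bool \<Rightarrow> real \<times> real \<times> real \<Rightarrow> real" where
    "h c = (\<lambda>(x, y, z). if c then ln z / ln x else ln (1 - z) / ln y)" for c
  have h: "h c \<in> borel_measurable borel" for c
    unfolding h_def borel_prod[symmetric] by measurable
  have h_X: "h True (X n \<omega>) = ln (p n \<omega>) / ln (a n \<omega>)"
    "h False (X n \<omega>) = ln (1 - p n \<omega>) / ln (b n \<omega>)" for n \<omega>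
    by (simp_all add: h_def X_def)
  define S where "S c = esssup M (\<lambda>\<omega>. ereal (h c (X 1 \<omega>)))" for c
  define I where "I c = essinf M (\<lambda>\<omega>. ereal (h c (X 1 \<omega>)))" for c
  have \<alpha>: "\<alpha> = max (S True) (S False)" and \<beta>: "\<beta> = min (I True) (I False)"
    by (simp_all add: \<alpha>_def \<beta>_def S_def I_def h_X)
  have p_01: "0 \<le> p n \<omega>" "p n \<omega> \<le> 1" if "1 \<le> n" "\<omega> \<in> space M" for n \<omega>
    using range[OF that] by (auto simp: moran_parameters_def)
  have p_meas: "p n \<in> borel_measurable M" if "1 \<le> n" for n
  proof -
    have "(\<lambda>\<omega>. snd (snd (X n \<omega>))) \<in> borel_measurable M"
      using rv[OF that] unfolding borel_prod[symmetric] by measurable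
    thus ?thesis by (simp add: X_def)
  qed
  have AE_p: "AE \<omega> in M. \<forall>n\<ge>1. 0 < p n \<omega> \<and> p n \<omega> < 1"
  proof -
    obtain t where t: "\<And>n. 1 \<le> n \<Longrightarrow> (\<integral>\<^sup>+\<omega>. inverse (ennreal (p n \<omega> powr t)) \<partial>M) < \<infinity>"
      "\<And>n. 1 \<le> n \<Longrightarrow> (\<integral>\<^sup>+\<omega>. inverse (ennreal ((1 - p n \<omega>) powr t)) \<partial>M) < \<infinity>"
      using moments by blast
    have "AE \<omega> in M. 0 < p n \<omega>" if "1 \<le> n" for n
      using p_01[OF that] by (intro AE_pos_of_inverse_moment[OF p_meas[OF that] _ t(1)[OF that]])
    moreover have "AE \<omega> in M. 0 < 1 - p n \<omega>" if "1 \<le> n" for n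
      using p_01[OF that] p_meas[OF that]
      by (intro AE_pos_of_inverse_moment[OF _ _ t(2)[OF that]]) simp_all
    ultimately show ?thesis by (simp add: AE_all_countable)
  qed
  have AE_S: "AE \<omega> in M. (\<forall>n\<ge>1. ereal (h c (X n \<omega>)) \<le> S c) \<and>
      (\<forall>d. ereal d < S c \<longrightarrow> log_runs (\<lambda>n. d < h c (X n \<omega>)))" for c
    unfolding S_def by (rule AE_log_runs_esssup[OF indep_X ident_X h])
  have AE_I: "AE \<omega> in M. (\<forall>n\<ge>1. I c \<le> ereal (h c (X n \<omega>))) \<and>
      (\<forall>d. I c < ereal d \<longrightarrow> log_runs (\<lambda>n. h c (X n \<omega>) < d))" for c
    unfolding I_def by (rule AE_log_runs_essinf[OF indep_X ident_X h])
  have "AE \<omega> in M. (\<forall>n\<ge>1. 0 < p n \<omega> \<and> p n \<omega> < 1) \<and>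
    (\<forall>c. (\<forall>n\<ge>1. ereal (h c (X n \<omega>)) \<le> S c) \<and>
         (\<forall>d. ereal d < S c \<longrightarrow> log_runs (\<lambda>n. d < h c (X n \<omega>)))) \<and>
    (\<forall>c. (\<forall>n\<ge>1. I c \<le> ereal (h c (X n \<omega>))) \<and>
         (\<forall>d. I c < ereal d \<longrightarrow> log_runs (\<lambda>n. h c (X n \<omega>) < d)))"
    (is "AE \<omega> in M. ?good \<omega>")
    by (intro AE_conjI AE_p AE_all_countable[THEN iffD2] allI AE_S AE_I)
  then obtain N where N: "{\<omega>\<in>space M. \<not> ?good \<omega>} \<subseteq> N" "emeasure M N = 0" "N \<in> sets M"
    by (rule AE_E)
  show ?thesis
  proof (intro bexI[of _ "space M - N"] conjI ballI allI impI)
    show "space M - N \<in> sets M" using N(3) by auto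
    have "prob N = 0" using N(2) by (simp add: measure_def)
    thus "measure M (space M - N) = 1" using prob_compl[OF N(3)] by simp
  next
    fix \<omega> \<Phi> assume "\<omega> \<in> space M - N" and \<Phi>: "dimension_function \<Phi> \<and> small \<Phi>"
    hence \<omega>: "\<omega> \<in> space M" and good: "?good \<omega>" using N(1) by blast+
    have params: "(a n \<omega>, b n \<omega>, p n \<omega>) \<in> moran_parameters A B" if "1 \<le> n" for n
      using range[OF that \<omega>] .
    interpret moran_system "\<lambda>n. a n \<omega>" "\<lambda>n. b n \<omega>" "\<lambda>n. p n \<omega>" A B "\<mu> \<omega>"
      using params good \<open>0 < 2 * A\<close> \<open>B < 1\<close> mu[OF \<omega>]
      by unfold_locales (auto simp: moran_parameters_def)
    have local_exponent: "local_exponent \<sigma> n = h (\<sigma> n) (X n \<omega>)" for \<sigma> n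
      by (auto simp: local_exponent_def h_def X_def weight_def ratio_def)
    show "upper_dim \<Phi> (\<mu> \<omega>) = \<alpha>"
    proof (rule upper_dim_eq)
      show "ereal (local_exponent \<sigma> n) \<le> \<alpha>" if "1 \<le> n" for \<sigma> n
        using good that unfolding local_exponent \<alpha>
        by (cases "\<sigma> n") (auto simp: le_max_iff_disj)
      show "\<exists>c. log_runs (\<lambda>n. d < local_exponent (\<lambda>_. c) n)" if "ereal d < \<alpha>" for d
        using good that unfolding local_exponent \<alpha> less_max_iff_disj by blast
    qed (use \<Phi> in auto)
    show "lower_dim \<Phi> (\<mu> \<omega>) = \<beta>"
    proof (rule lower_dim_eq)
      show "\<beta> \<le> ereal (local_exponent \<sigma> n)" if "1 \<le> n" for \<sigma> n
        using good that unfolding local_exponent \<beta>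
        by (cases "\<sigma> n") (auto simp: min_le_iff_disj)
      show "\<exists>c. log_runs (\<lambda>n. local_exponent (\<lambda>_. c) n < d)" if "\<beta> < ereal d" for d
        using good that unfolding local_exponent \<beta> min_less_iff_disj by blast
    qed (use \<Phi> in auto)
  qed
qed

end
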